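(* Let $m\ge1$, $\varepsilon(1),\ldots,\varepsilon(m)\in\{-1,1\}$, $f_1,\ldots,f_m\in\mathcal{R}^\infty([0,1])$, and $0\le s_i<t_i\le 1$ for $i=1,\ldots,m$. Then $$\lim_{N\to\infty}\omega_\Omega\big(S_{N,[s_1,t_1]}^{\varepsilon(1)}(a,f_1)\cdots S_{N,[s_m,t_m]}^{\varepsilon(m)}(a,f_m)\big)= \begin{cases}0 & \text{if } m \text{ is odd},\\[2pt] \omega_\Omega\big(a^{\varepsilon(1)}(f_1\chi_{[s_1,t_1]})\cdots a^{\varepsilon(2n)}(f_{2n}\chi_{[s_{2n},t_{2n}]})\big) & \text{if } m=2n,\end{cases}$$ where $\omega_\Omega$ on the left is the vacuum state on the discrete monotone Fock space and $\omega_\Omega$ on the right is the vacuum state on the continuous monotone Fock space over $[0,1]$.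
   Context: $\mathcal{R}^\infty([0,1])$ denotes the set of bounded complex-valued Riemann integrable functions on $[0,1]$; $\chi_A$ is the indicator function of $A$; for $x\in\mathbb{R}$, $[x]$ is the unique integer with $[x]\le x<[x]+1$. Discrete monotone Fock space. For $k\ge 1$ let $I_k$ be the set of strictly increasing sequences $(i_1<i_2<\cdots<i_k)$ of natural numbers, and $I_0=\{\emptyset\}$. The discrete monotone Fock space is $\mathcal{F}_m=\bigoplus_{k=0}^\infty \ell^2(I_k)$, with canonical orthonormal basis $e_\alpha$, $\alpha\in\bigcup_k I_k$, and vacuum $\Omega=e_\emptyset$. For $i\in\mathbb{N}$ the monotone creation operator is the bounded operator with $a_i^\dagger e_{(i_1,\ldots,i_k)}=e_{(i,i_1,\ldots,i_k)}$ if $i<i_1$ (or if $k=0$) and $0$ otherwise; the monotone annihilation operator $a_i$ is its adjoint: $a_i e_{(i_1,\ldots,i_k)}=e_{(i_2,\ldots,i_k)}$ if $k\ge1$ and $i=i_1$, and $0$ otherwise. Write $a_i^{1}=a_i^\dagger$, $a_i^{-1}=a_i$. For $f\in\mathcal{R}^\infty([0,1])$, $N\ge 1$ and $0\le s<t\le1$ set $$S_{N,[s,t]}^{1}(a,f)=\frac1{\sqrt N}\sum_{k=[Ns]+1}^{[Nt]} f\Big(\frac kN\Big)a_k^\dagger,\qquad S_{N,[s,t]}^{-1}(a,f)=\frac1{\sqrt N}\sum_{k=[Ns]+1}^{[Nt]} \overline{f\Big(\frac kN\Big)}\,a_k .$$ Continuous monotone Fock space over $J=[0,1]$. For $n\ge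 1$ let $J^n_+=\{(t_1,\ldots,t_n)\in[0,1]^n: t_1<\cdots<t_n\}$ and $\mathfrak{h}_n=L^2(J^n_+)$ with respect to Lebesgue measure, and $\mathfrak{h}_0=\mathbb{C}\Omega$, with $\Omega$ a unit vector (the vacuum). Set $\Gamma_M=\bigoplus_{n\ge0}\mathfrak{h}_n$ (Hilbert space direct sum; inner products are linear in the second variable). For $f\in L^2([0,1])$, the creation operator $a^\dagger(f)$ is the bounded operator mapping $\mathfrak{h}_n$ to $\mathfrak{h}_{n+1}$ by $[a^\dagger(f)g](t,t_1,\ldots,t_n)=f(t)g(t_1,\ldots,t_n)$ on $t<t_1<\cdots<t_n$ (and $a^\dagger(f)\Omega=f$); the annihilation operator $a(f)$ is its adjoint, so $a(f)\Omega=0$, $a(f)g=\big(\int_0^1\overline{f(t)}g(t)\,dt\big)\Omega$ for $g\in\mathfrak{h}_1$, and $[a(f)g](t_1,\ldots,t_n)=\int_{t<t_1}\overline{f(t)}g(t,t_1,\ldots,t_n)\,dt$ for $g\in\mathfrak{h}_{n+1}$, $n\ge1$. Write $a^1(f)=a^\dagger(f)$, $a^{-1}(f)=a(f)$. In either Fock space, $\omega_\Omega(X)=\langle\Omega,X\Omega\rangle$ is the vacuum state. *)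

theory Defs
  imports "HOL-Probability.Probability"
begin

section \<open>Bounded Riemann integrable functions on the unit interval\<close>

text \<open>Riemann sums over tagged divisions, with the mesh (and not a gauge) tending to 0. Functions
  are defined on all of the reals, but only their values on the unit interval matter.\<close>

definition riemann_integrable_01 :: "(real \<Rightarrow> complex) \<Rightarrow> bool" where
  "riemann_integrable_01 f \<longleftrightarrow> (\<exists>I. \<forall>e>0. \<exists>d>0. \<forall>p.
     p tagged_division_of {0..1} \<and> (\<forall>(x, K)\<in>p. diameter K < d) \<longrightarrow>
     cmod ((\<Sum>(x, K)\<in>p. measure lborel K *\<^sub>R f x) - I) < e)"

definition riemann_bounded_01 :: "(real \<Rightarrow> complex) set" where
  "riemann_bounded_01 = {f. bounded (f ` {0..1}) \<and> riemann_integrable_01 f}"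

section \<open>Ordered products of operators\<close>

definition op_prod :: "(nat \<Rightarrow> 'a \<Rightarrow> 'a) \<Rightarrow> nat \<Rightarrow> 'a \<Rightarrow> 'a" where
  "op_prod A m = foldr (\<lambda>i X. A i \<circ> X) [1..<Suc m] id"

lemma op_prod_0 [simp]: "op_prod A 0 = id"
  by (simp add: op_prod_def)

lemma op_prod_Suc: "op_prod A (Suc m) = op_prod A m \<circ> A (Suc m)"
proof -
  have "foldr (\<lambda>i X. A i \<circ> X) xs Y = foldr (\<lambda>i X. A i \<circ> X) xs id \<circ> Y" for xs Y
    by (induction xs) (auto simp: o_assoc)
  from this[of "[1..<Suc m]" "A (Suc m)"] show ?thesis
    by (simp add: op_prod_def)
qed

section \<open>The discrete monotone Fock space\<close>

text \<open>The direct sum of the spaces of square summable families on sequences of fixed length is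
  the space of square summable families on strictly increasing sequences of arbitrary length.\<close>

definition incr_seqs :: "nat list set" where
  "incr_seqs = {\<alpha>. sorted_wrt (<) \<alpha>}"

definition dfock :: "(nat list \<Rightarrow> complex) set" where
  "dfock = {x. (\<forall>\<alpha>. \<alpha> \<notin> incr_seqs \<longrightarrow> x \<alpha> = 0) \<and>
               (\<lambda>\<alpha>. (cmod (x \<alpha>))\<^sup>2) summable_on incr_seqs}"

definition dinner :: "(nat list \<Rightarrow> complex) \<Rightarrow> (nat list \<Rightarrow> complex) \<Rightarrow> complex" where
  "dinner x y = (\<Sum>\<^sub>\<infinity>\<alpha>\<in>incr_seqs. cnj (x \<alpha>) * y \<alpha>)"

definition dbasis :: "nat list \<Rightarrow> nat list \<Rightarrow> complex" where
  "dbasis \<alpha> = (\<lambda>\<beta>. if \<beta> = \<alpha> then 1 else 0)"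

definition dvacuum :: "nat list \<Rightarrow> complex" where
  "dvacuum = dbasis []"

text \<open>The actions on the canonical basis are \<open>dcreate_dbasis\<close> and
  \<open>dannihilate_dbasis\<close> below; adjointness is \<open>dinner_dannihilate\<close>.\<close>

definition dcreate :: "nat \<Rightarrow> (nat list \<Rightarrow> complex) \<Rightarrow> nat list \<Rightarrow> complex" where
  "dcreate i x = (\<lambda>\<alpha>. case \<alpha> of [] \<Rightarrow> 0
     | j # \<beta> \<Rightarrow> if j = i \<and> i # \<beta> \<in> incr_seqs then x \<beta> else 0)"

definition dannihilate :: "nat \<Rightarrow> (nat list \<Rightarrow> complex) \<Rightarrow> nat list \<Rightarrow> complex" where
  "dannihilate i x = (\<lambda>\<beta>. if i # \<beta> \<in> incr_seqs then x (i # \<beta>) else 0)"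

definition dS :: "nat \<Rightarrow> real \<Rightarrow> real \<Rightarrow> int \<Rightarrow> (real \<Rightarrow> complex) \<Rightarrow>
    (nat list \<Rightarrow> complex) \<Rightarrow> nat list \<Rightarrow> complex" where
  "dS N s t \<epsilon> f = (\<lambda>x \<alpha>. 1 / complex_of_real (sqrt (real N)) *
     (\<Sum>k = nat \<lfloor>real N * s\<rfloor> + 1 .. nat \<lfloor>real N * t\<rfloor>.
        if \<epsilon> = 1 then f (real k / real N) * dcreate k x \<alpha>
        else cnj (f (real k / real N)) * dannihilate k x \<alpha>))"

definition dvacuum_state ::
    "((nat list \<Rightarrow> complex) \<Rightarrow> nat list \<Rightarrow> complex) \<Rightarrow> complex" where
  "dvacuum_state X = dinner dvacuum (X dvacuum)"

lemma incr_seqs_Cons: "i # \<alpha> \<in> incr_seqs \<longleftrightarrow> (\<alpha> = [] \<or> i < hd \<alpha>) \<and> \<alpha> \<in> incr_seqs"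
  by (cases \<alpha>) (auto simp: incr_seqs_def)

lemma incr_seqs_Nil [simp]: "[] \<in> incr_seqs"
  by (simp add: incr_seqs_def)

lemma dbasis_in_dfock:
  assumes "\<alpha> \<in> incr_seqs" shows "dbasis \<alpha> \<in> dfock"
proof -
  have "(\<lambda>\<beta>. (cmod (dbasis \<alpha> \<beta>))\<^sup>2) summable_on {\<alpha>}"
    by (rule summable_on_finite) simp
  then have "(\<lambda>\<beta>. (cmod (dbasis \<alpha> \<beta>))\<^sup>2) summable_on incr_seqs"
    by (rule summable_on_cong_neutral[THEN iffD1, rotated -1])
       (use assms in \<open>auto simp: dbasis_def\<close>)
  with assms show ?thesis by (auto simp: dfock_def dbasis_def)
qed

lemma dcreate_dbasis:
  assumes "\<alpha> \<in> incr_seqs"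
  shows "dcreate i (dbasis \<alpha>) = (if \<alpha> = [] \<or> i < hd \<alpha> then dbasis (i # \<alpha>) else (\<lambda>_. 0))"
  using assms by (auto simp: dcreate_def dbasis_def fun_eq_iff incr_seqs_Cons split: list.splits)

lemma dannihilate_dbasis:
  assumes "\<alpha> \<in> incr_seqs"
  shows "dannihilate i (dbasis \<alpha>) =
    (if \<alpha> \<noteq> [] \<and> i = hd \<alpha> then dbasis (tl \<alpha>) else (\<lambda>_. 0))"
  using assms by (cases \<alpha>) (auto simp: dannihilate_def dbasis_def fun_eq_iff)

lemma Cons_image_incr_seqs:
  "bij_betw ((#) i) {\<beta>. i # \<beta> \<in> incr_seqs} {\<alpha>\<in>incr_seqs. \<alpha> \<noteq> [] \<and> hd \<alpha> = i}"
  by (rule bij_betw_byWitness[where f' = tl]) (auto simp: neq_Nil_conv)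

lemma dcreate_in_dfock:
  assumes x: "x \<in> dfock" shows "dcreate i x \<in> dfock"
proof -
  have "(\<lambda>\<beta>. (cmod (x \<beta>))\<^sup>2) summable_on {\<beta>. i # \<beta> \<in> incr_seqs}"
    using x by (auto simp: dfock_def incr_seqs_Cons intro: summable_on_subset_banach)
  then have "(\<lambda>\<alpha>. (cmod (x (tl \<alpha>)))\<^sup>2) summable_on {\<alpha>\<in>incr_seqs. \<alpha> \<noteq> [] \<and> hd \<alpha> = i}"
    using summable_on_reindex_bij_betw[OF Cons_image_incr_seqs[of i],
        of "\<lambda>\<alpha>. (cmod (x (tl \<alpha>)))\<^sup>2"] by simp
  then have "(\<lambda>\<alpha>. (cmod (dcreate i x \<alpha>))\<^sup>2) summable_on incr_seqs"
    by (rule summable_on_cong_neutral[THEN iffD1, rotated -1])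
       (auto simp: dcreate_def split: list.splits)
  then show ?thesis by (auto simp: dfock_def dcreate_def incr_seqs_Cons split: list.splits)
qed

lemma dannihilate_in_dfock:
  assumes x: "x \<in> dfock" shows "dannihilate i x \<in> dfock"
proof -
  have "(\<lambda>\<alpha>. (cmod (x \<alpha>))\<^sup>2) summable_on {\<alpha>\<in>incr_seqs. \<alpha> \<noteq> [] \<and> hd \<alpha> = i}"
    using x by (auto simp: dfock_def intro: summable_on_subset_banach)
  then have "(\<lambda>\<beta>. (cmod (x (i # \<beta>)))\<^sup>2) summable_on {\<beta>. i # \<beta> \<in> incr_seqs}"
    using summable_on_reindex_bij_betw[OF Cons_image_incr_seqs[of i],
        of "\<lambda>\<alpha>. (cmod (x \<alpha>))\<^sup>2"] by simp
  then have "(\<lambda>\<beta>. (cmod (dannihilate i x \<beta>))\<^sup>2) summable_on incr_seqs"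
    by (rule summable_on_cong_neutral[THEN iffD1, rotated -1])
       (auto simp: dannihilate_def incr_seqs_Cons)
  then show ?thesis by (auto simp: dfock_def dannihilate_def incr_seqs_Cons)
qed

lemma dinner_dannihilate: "dinner (dannihilate i x) y = dinner x (dcreate i y)"
proof -
  have "dinner (dannihilate i x) y = (\<Sum>\<^sub>\<infinity>\<beta>\<in>{\<beta>. i # \<beta> \<in> incr_seqs}. cnj (x (i # \<beta>)) * y \<beta>)"
    unfolding dinner_def
    by (rule infsum_cong_neutral) (auto simp: dannihilate_def incr_seqs_Cons)
  also have "\<dots> = (\<Sum>\<^sub>\<infinity>\<alpha>\<in>{\<alpha>\<in>incr_seqs. \<alpha> \<noteq> [] \<and> hd \<alpha> = i}. cnj (x \<alpha>) * y (tl \<alpha>))"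
    by (subst infsum_reindex_bij_betw[OF Cons_image_incr_seqs, symmetric]) simp
  also have "\<dots> = dinner x (dcreate i y)"
    unfolding dinner_def
    by (rule infsum_cong_neutral) (auto simp: dcreate_def neq_Nil_conv split: list.splits)
  finally show ?thesis .
qed

section \<open>The continuous monotone Fock space over the unit interval\<close>

text \<open>Points of n-dimensional space are the functions on the first n natural numbers, so that
  coordinates are numbered from 0. The product of Lebesgue measures is not completed;
  this does not change the space of square integrable functions up to null sets. The factors must
  be complete because a Riemann integrable function need not be Borel measurable.\<close>

abbreviation LI :: "real measure" where
  "LI \<equiv> lebesgue_on {0..1}"

definition incr_simplex :: "nat \<Rightarrow> (nat \<Rightarrow> real) set" where
  "incr_simplex n = {t \<in> {..<n} \<rightarrow>\<^sub>E {0..1}. strict_mono_on {..<n} t}"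

definition simplex_measure :: "nat \<Rightarrow> (nat \<Rightarrow> real) measure" where
  "simplex_measure n = restrict_space (\<Pi>\<^sub>M i\<in>{..<n}. LI) (incr_simplex n)"

definition L2 :: "'a measure \<Rightarrow> ('a \<Rightarrow> complex) set" where
  "L2 M = {g \<in> borel_measurable M. integrable M (\<lambda>x. (cmod (g x))\<^sup>2)}"

text \<open>A vector is represented by its sequence of components, each component being a square
  integrable function; two such sequences represent the same vector iff they are related by
  \<open>cfock_eq\<close>. The measure \<open>simplex_measure 0\<close> is a point mass, so
  the component of degree 0 is a scalar.\<close>

type_synonym cvec = "nat \<Rightarrow> (nat \<Rightarrow> real) \<Rightarrow> complex"

definition cfock :: "cvec set" where
  "cfock = {g. (\<forall>n. g n \<in> L2 (simplex_measure n)) \<and>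
               summable (\<lambda>n. \<integral>t. (cmod (g n t))\<^sup>2 \<partial>simplex_measure n)}"

definition cfock_eq :: "cvec \<Rightarrow> cvec \<Rightarrow> bool" where
  "cfock_eq g h \<longleftrightarrow> (\<forall>n. AE t in simplex_measure n. g n t = h n t)"

definition cinner :: "cvec \<Rightarrow> cvec \<Rightarrow> complex" where
  "cinner g h = (\<Sum>n. \<integral>t. cnj (g n t) * h n t \<partial>simplex_measure n)"

definition cvacuum :: cvec where
  "cvacuum n = (\<lambda>t. if n = 0 then 1 else 0)"

definition ccreate :: "(real \<Rightarrow> complex) \<Rightarrow> cvec \<Rightarrow> cvec" where
  "ccreate f g n = (\<lambda>t. case n of 0 \<Rightarrow> 0 | Suc k \<Rightarrow> f (t 0) * g k (\<lambda>i. t (Suc i)))"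

text \<open>\<open>case_nat u t\<close> is the point with coordinates \<open>u, t 0, \<dots>, t (n - 1)\<close>.\<close>

definition cannihilate :: "(real \<Rightarrow> complex) \<Rightarrow> cvec \<Rightarrow> cvec" where
  "cannihilate f g n = (\<lambda>t. LINT u:{u. n = 0 \<or> u < t 0}|LI.
     cnj (f u) * g (Suc n) (case_nat u t))"

text \<open>As in \<open>dS\<close>, the sign is 1 for creation and -1 for annihilation.\<close>

definition cmode :: "int \<Rightarrow> (real \<Rightarrow> complex) \<Rightarrow> cvec \<Rightarrow> cvec" where
  "cmode \<epsilon> f = (if \<epsilon> = 1 then ccreate f else cannihilate f)"

definition cvacuum_state :: "(cvec \<Rightarrow> cvec) \<Rightarrow> complex" where
  "cvacuum_state X = cinner cvacuum (X cvacuum)"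

text \<open>For square integrable f both operators map \<open>cfock\<close> to itself, respect
  \<open>cfock_eq\<close>, and are adjoint to each other.\<close>

lemma prob_space_LI: "prob_space LI"
  by (rule prob_spaceI) (simp add: emeasure_restrict_space)

interpretation LI: prob_space LI by (rule prob_space_LI)
interpretation LIs: product_sigma_finite "\<lambda>_::nat. LI" ..

lemma borel_measurable_LI: "(\<lambda>x. x) \<in> borel_measurable LI"
  by (intro measurable_restrict_space1 measurable_completion) simp

lemma case_nat_PiE:
  "case_nat u t \<in> Pi\<^sub>E {..<Suc n} A \<longleftrightarrow> u \<in> A 0 \<and> t \<in> Pi\<^sub>E {..<n} (\<lambda>i. A (Suc i))"
proof -
  have all_nat: "(\<forall>i. P i) \<longleftrightarrow> P 0 \<and> (\<forall>i. P (Suc i))" for P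
    by (metis nat.exhaust)
  show ?thesis
    unfolding PiE_iff extensional_def Ball_def mem_Collect_eq
    by (subst (1 2) all_nat) simp
qed

lemma shift_PiE: "t \<in> Pi\<^sub>E {..<Suc n} A \<Longrightarrow> (\<lambda>i. t (Suc i)) \<in> Pi\<^sub>E {..<n} (\<lambda>i. A (Suc i))"
  by (simp add: PiE_iff extensional_def)

lemma measurable_case_nat_PiM:
  "(\<lambda>(u, t). case_nat u t) \<in> measurable (LI \<Otimes>\<^sub>M (\<Pi>\<^sub>M i\<in>{..<n}. LI)) (\<Pi>\<^sub>M i\<in>{..<Suc n}. LI)"
proof (rule measurable_PiM_single')
  show "(\<lambda>\<omega>. (case \<omega> of (u, t) \<Rightarrow> case_nat u t) i) \<in> measurable (LI \<Otimes>\<^sub>M (\<Pi>\<^sub>M i\<in>{..<n}. LI)) LI"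
    if "i \<in> {..<Suc n}" for i
    using that by (cases i) (auto simp: split_beta')
  show "(\<lambda>(u, t). case_nat u t) \<in> space (LI \<Otimes>\<^sub>M (\<Pi>\<^sub>M i\<in>{..<n}. LI)) \<rightarrow> {..<Suc n} \<rightarrow>\<^sub>E space LI"
    by (clarsimp simp: space_pair_measure space_PiM case_nat_PiE)
qed

lemma measurable_shift_PiM:
  "(\<lambda>t i. t (Suc i)) \<in> measurable (\<Pi>\<^sub>M i\<in>{..<Suc n}. LI) (\<Pi>\<^sub>M i\<in>{..<n}. LI)"
proof (rule measurable_PiM_single')
  show "(\<lambda>t i. t (Suc i)) \<in> space (\<Pi>\<^sub>M i\<in>{..<Suc n}. LI) \<rightarrow> {..<n} \<rightarrow>\<^sub>E space LI"
    using shift_PiE by (auto simp: space_PiM)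
qed simp

lemma distr_case_nat:
  "distr (LI \<Otimes>\<^sub>M (\<Pi>\<^sub>M i\<in>{..<n}. LI)) (\<Pi>\<^sub>M i\<in>{..<Suc n}. LI) (\<lambda>(u, t). case_nat u t) =
   (\<Pi>\<^sub>M i\<in>{..<Suc n}. LI)"
proof (rule LIs.PiM_eqI)
  interpret P: finite_product_sigma_finite "\<lambda>_::nat. LI" "{..<n}" by standard simp
  fix A :: "nat \<Rightarrow> real set" assume A: "\<And>i. i \<in> {..<Suc n} \<Longrightarrow> A i \<in> sets LI"
  have sub: "A i \<subseteq> {0..1}" if "i < Suc n" for i
    using sets.sets_into_space[OF A[of i]] that by simp
  have "(\<lambda>(u, t). case_nat u t) -` Pi\<^sub>E {..<Suc n} A \<inter> space (LI \<Otimes>\<^sub>M (\<Pi>\<^sub>M i\<in>{..<n}. LI))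
      = A 0 \<times> Pi\<^sub>E {..<n} (\<lambda>i. A (Suc i))"
  proof (intro set_eqI)
    fix p :: "real \<times> (nat \<Rightarrow> real)"
    obtain u t where p: "p = (u, t)" by force
    have "u \<in> {0..1}" if "u \<in> A 0" using sub[of 0] that by auto
    moreover have "t \<in> {..<n} \<rightarrow>\<^sub>E {0..1}" if "t \<in> Pi\<^sub>E {..<n} (\<lambda>i. A (Suc i))"
      using sub that by (force simp: PiE_iff)
    ultimately show "p \<in> (\<lambda>(u, t). case_nat u t) -` Pi\<^sub>E {..<Suc n} A \<inter> space (LI \<Otimes>\<^sub>M (\<Pi>\<^sub>M i\<in>{..<n}. LI))
      \<longleftrightarrow> p \<in> A 0 \<times> Pi\<^sub>E {..<n} (\<lambda>i. A (Suc i))"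
      by (auto simp: p space_pair_measure space_PiM case_nat_PiE)
  qed
  then show "emeasure (distr (LI \<Otimes>\<^sub>M (\<Pi>\<^sub>M i\<in>{..<n}. LI)) (\<Pi>\<^sub>M i\<in>{..<Suc n}. LI)
      (\<lambda>(u, t). case_nat u t)) (Pi\<^sub>E {..<Suc n} A) = (\<Prod>i<Suc n. emeasure LI (A i))"
    using A P.measure_times[of "\<lambda>i. A (Suc i)"]
    by (subst emeasure_distr) (simp_all add: measurable_case_nat_PiM P.emeasure_pair_measure_Times
        prod.lessThan_Suc_shift del: prod.lessThan_Suc)
qed simp_all

lemma incr_simplex_sets: "incr_simplex n \<in> sets (\<Pi>\<^sub>M i\<in>{..<n}. LI)"
proof -
  have "incr_simplex n = {t \<in> space (\<Pi>\<^sub>M i\<in>{..<n}. LI). \<forall>i\<in>{..<n}. \<forall>j\<in>{..<n}. i < j \<longrightarrow> t i < t j}"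
    by (auto simp: incr_simplex_def space_PiM strict_mono_on_def)
  also have "\<dots> \<in> sets (\<Pi>\<^sub>M i\<in>{..<n}. LI)"
  proof (intro sets.sets_Collect_finite_All)
    fix i j assume ij: "i \<in> {..<n}" "j \<in> {..<n}"
    have comp: "(\<lambda>t. t k) \<in> borel_measurable (\<Pi>\<^sub>M i\<in>{..<n}. LI)" if "k \<in> {..<n}" for k
      by (rule measurable_compose[OF measurable_component_singleton[OF that] borel_measurable_LI])
    show "{t \<in> space (\<Pi>\<^sub>M i\<in>{..<n}. LI). i < j \<longrightarrow> t i < t j} \<in> sets (\<Pi>\<^sub>M i\<in>{..<n}. LI)"
      using borel_measurable_less[OF comp[OF ij(1)] comp[OF ij(2)]] by (cases "i < j") simp_all
  qed simp_all
  finally show ?thesis .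
qed

lemma space_simplex_measure: "space (simplex_measure n) = incr_simplex n"
  using sets.sets_into_space[OF incr_simplex_sets[of n]]
  by (auto simp: simplex_measure_def space_restrict_space)

lemma strict_mono_on_lessThan:
  "strict_mono_on {..<n::nat} t \<longleftrightarrow> (\<forall>j<n. \<forall>i<j. t i < t j)"
  by (auto simp: strict_mono_on_def)

lemma case_nat_incr_simplex:
  assumes "u \<in> {0..1}" "t \<in> {..<n} \<rightarrow>\<^sub>E {0..1}"
  shows "case_nat u t \<in> incr_simplex (Suc n) \<longleftrightarrow> t \<in> incr_simplex n \<and> (n = 0 \<or> u < t 0)"
proof -
  have "(\<forall>j<n. u < t j \<and> (\<forall>i<j. t i < t j)) \<longleftrightarrow>
      (\<forall>j<n. \<forall>i<j. t i < t j) \<and> (n = 0 \<or> u < t 0)"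
  proof (intro iffI conjI allI impI)
    fix j assume *: "(\<forall>j<n. \<forall>i<j. t i < t j) \<and> (n = 0 \<or> u < t 0)" and j: "j < n"
    show "u < t j"
    proof (cases "j = 0")
      case False
      with * j have "u < t 0" "t 0 < t j" by blast+
      then show ?thesis by (rule less_trans)
    qed (use * j in blast)
  qed blast+
  then show ?thesis
    using assms unfolding incr_simplex_def mem_Collect_eq strict_mono_on_lessThan All_less_Suc2
    by (simp add: case_nat_PiE All_less_Suc2)
qed

lemma shift_incr_simplex: "t \<in> incr_simplex (Suc n) \<Longrightarrow> (\<lambda>i. t (Suc i)) \<in> incr_simplex n"
  using shift_PiE[of t n "\<lambda>_. {0..1}"] by (auto simp: incr_simplex_def strict_mono_on_def)

lemma measurable_simplex_id:
  "(\<lambda>t. t) \<in> measurable (simplex_measure n) (\<Pi>\<^sub>M i\<in>{..<n}. LI)"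
  unfolding simplex_measure_def by (rule measurable_restrict_space1) simp

lemma measurable_simplex_component:
  "i < n \<Longrightarrow> (\<lambda>t. t i) \<in> measurable (simplex_measure n) LI"
  by (rule measurable_compose[OF measurable_simplex_id measurable_component_singleton]) simp

lemma measurable_simplex_shift:
  "(\<lambda>t i. t (Suc i)) \<in> measurable (simplex_measure (Suc n)) (simplex_measure n)"
proof -
  have "(\<lambda>t i. t (Suc i)) \<in> measurable (simplex_measure (Suc n)) (\<Pi>\<^sub>M i\<in>{..<n}. LI)"
    by (rule measurable_compose[OF measurable_simplex_id measurable_shift_PiM])
  then show ?thesis
    unfolding simplex_measure_def[of n]
    by (rule measurable_restrict_space2[rotated]) (auto simp: space_simplex_measure shift_incr_simplex)
qed

text \<open>\<open>cone_measure n\<close> lives on the pairs \<open>(u, t)\<close> with u below all coordinates of t.\<close>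

definition cone_set :: "nat \<Rightarrow> (real \<times> (nat \<Rightarrow> real)) set" where
  "cone_set n = {(u, t). n = 0 \<or> u < t 0}"

definition cone_measure :: "nat \<Rightarrow> (real \<times> (nat \<Rightarrow> real)) measure" where
  "cone_measure n = restrict_space (LI \<Otimes>\<^sub>M simplex_measure n) (cone_set n)"

lemma cone_set_sets: "cone_set n \<inter> space (LI \<Otimes>\<^sub>M simplex_measure n) \<in> sets (LI \<Otimes>\<^sub>M simplex_measure n)"
proof (cases n)
  case (Suc k)
  have [measurable]: "(\<lambda>t. t 0) \<in> borel_measurable (simplex_measure (Suc k))"
    by (rule measurable_compose[OF measurable_simplex_component borel_measurable_LI]) simp
  have [measurable]: "(\<lambda>x. x) \<in> borel_measurable LI" by (rule borel_measurable_LI)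
  have "cone_set n \<inter> space (LI \<Otimes>\<^sub>M simplex_measure n) =
    {p \<in> space (LI \<Otimes>\<^sub>M simplex_measure (Suc k)). fst p < snd p 0}"
    by (auto simp: cone_set_def Suc)
  also have "\<dots> \<in> sets (LI \<Otimes>\<^sub>M simplex_measure (Suc k))"
    by (intro borel_measurable_less measurable_compose[OF measurable_fst borel_measurable_LI]
        measurable_compose[OF measurable_snd, of "\<lambda>t. t 0"]) fact
  finally show ?thesis by (simp add: Suc)
qed (auto simp: cone_set_def)

lemma space_cone_measure:
  "space (cone_measure n) = {(u, t). u \<in> {0..1} \<and> t \<in> incr_simplex n \<and> (n = 0 \<or> u < t 0)}"
  by (auto simp: cone_measure_def space_restrict_space cone_set_def space_pair_measure space_simplex_measure)

lemma measurable_cone: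
  "(\<lambda>(u, t). case_nat u t) \<in> measurable (cone_measure n) (simplex_measure (Suc n))"
proof -
  have "(\<lambda>p. (fst p, snd p)) \<in> measurable (LI \<Otimes>\<^sub>M simplex_measure n) (LI \<Otimes>\<^sub>M (\<Pi>\<^sub>M i\<in>{..<n}. LI))"
    using measurable_simplex_id[of n] by (intro measurable_Pair measurable_compose[OF measurable_snd]) auto
  from measurable_compose[OF this measurable_case_nat_PiM]
  have "(\<lambda>(u, t). case_nat u t) \<in> measurable (LI \<Otimes>\<^sub>M simplex_measure n) (\<Pi>\<^sub>M i\<in>{..<Suc n}. LI)"
    by (simp only: split_beta' prod.sel)
  then have "(\<lambda>(u, t). case_nat u t) \<in> measurable (cone_measure n) (\<Pi>\<^sub>M i\<in>{..<Suc n}. LI)"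
    unfolding cone_measure_def by (rule measurable_restrict_space1)
  moreover have "(\<lambda>(u, t). case_nat u t) \<in> space (cone_measure n) \<rightarrow> incr_simplex (Suc n)"
  proof -
    have "case_nat u t \<in> incr_simplex (Suc n)" 
      if "u \<in> {0..1}" "t \<in> incr_simplex n" "n = 0 \<or> u < t 0" for u t
    proof -
      have "t \<in> {..<n} \<rightarrow>\<^sub>E {0..1}" using that(2) by (simp add: incr_simplex_def)
      with that show ?thesis using case_nat_incr_simplex by blast
    qed
    then show ?thesis unfolding space_cone_measure by (intro funcsetI) (elim CollectE case_prodE, simp)
  qed
  ultimately show ?thesis
    unfolding simplex_measure_def[of "Suc n"] by (intro measurable_restrict_space2)
qed

lemma finite_measure_simplex: "finite_measure (simplex_measure n)"
  unfolding simplex_measure_def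
  by (intro finite_measure_restrict_space incr_simplex_sets prob_space.axioms(1)
      prob_space_PiM prob_space_LI)

interpretation simplex: finite_measure "simplex_measure n" for n by (rule finite_measure_simplex)

interpretation LI_simplex: pair_sigma_finite LI "simplex_measure n" for n ..

lemma nn_integral_simplex_Suc:
  assumes "F \<in> borel_measurable (simplex_measure (Suc n))"
  shows "(\<integral>\<^sup>+ s. F s \<partial>simplex_measure (Suc n)) = (\<integral>\<^sup>+ p. F (case_nat (fst p) (snd p)) \<partial>cone_measure n)"
proof -
  interpret P: sigma_finite_measure "\<Pi>\<^sub>M i\<in>{..<n}. LI" by (rule LIs.sigma_finite) simp
  interpret PP: pair_sigma_finite LI "\<Pi>\<^sub>M i\<in>{..<n}. LI" ..
  let ?P = "\<lambda>n. \<Pi>\<^sub>M i\<in>{..<n::nat}. LI"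
  define G where "G = (\<lambda>s. F s * indicator (incr_simplex (Suc n)) s)"
  have G[measurable]: "G \<in> borel_measurable (?P (Suc n))"
    using assms incr_simplex_sets[of "Suc n"]
    unfolding G_def simplex_measure_def
    by (subst (asm) borel_measurable_restrict_space_iff_ennreal) (simp_all add: sets.Int_space_eq2)
  have "(\<integral>\<^sup>+ s. F s \<partial>simplex_measure (Suc n)) = (\<integral>\<^sup>+ s. G s \<partial>?P (Suc n))"
    unfolding simplex_measure_def G_def
    by (rule nn_integral_restrict_space) (simp add: incr_simplex_sets sets.Int_space_eq2)
  also have "\<dots> = (\<integral>\<^sup>+ p. G (case p of (u, t) \<Rightarrow> case_nat u t) \<partial>(LI \<Otimes>\<^sub>M ?P n))"
    by (subst distr_case_nat[symmetric], rule nn_integral_distr[OF measurable_case_nat_PiM]) (simp add: G)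
  also have "\<dots> = (\<integral>\<^sup>+ t. \<integral>\<^sup>+ u. G (case_nat u t) \<partial>LI \<partial>?P n)"
    using PP.nn_integral_snd[OF measurable_compose[OF measurable_case_nat_PiM[of n] G]] by simp
  also have "\<dots> = (\<integral>\<^sup>+ t. (\<integral>\<^sup>+ u. F (case_nat u t) * indicator (cone_set n) (u, t) \<partial>LI)
      * indicator (incr_simplex n) t \<partial>?P n)"
  proof (intro nn_integral_cong)
    fix t assume t: "t \<in> space (?P n)"
    have "(\<integral>\<^sup>+ u. G (case_nat u t) \<partial>LI) =
      (\<integral>\<^sup>+ u. F (case_nat u t) * indicator (cone_set n) (u, t) * indicator (incr_simplex n) t \<partial>LI)"
      using t by (intro nn_integral_cong)
        (auto simp: G_def cone_set_def case_nat_incr_simplex space_PiM indicator_def)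
    also have "\<dots> = (\<integral>\<^sup>+ u. F (case_nat u t) * indicator (cone_set n) (u, t) \<partial>LI) * indicator (incr_simplex n) t"
      by (auto simp: indicator_def)
    finally show "(\<integral>\<^sup>+ u. G (case_nat u t) \<partial>LI) =
      (\<integral>\<^sup>+ u. F (case_nat u t) * indicator (cone_set n) (u, t) \<partial>LI) * indicator (incr_simplex n) t" .
  qed
  also have "\<dots> = (\<integral>\<^sup>+ t. \<integral>\<^sup>+ u. F (case_nat u t) * indicator (cone_set n) (u, t) \<partial>LI \<partial>simplex_measure n)"
    unfolding simplex_measure_def
    by (rule nn_integral_restrict_space[symmetric]) (simp add: incr_simplex_sets sets.Int_space_eq2)
  also have "\<dots> = (\<integral>\<^sup>+ p. F (case_nat (fst p) (snd p)) * indicator (cone_set n) p \<partial>(LI \<Otimes>\<^sub>M simplex_measure n))"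
  proof -
    have "(\<lambda>p. F (case_nat (fst p) (snd p))) \<in> borel_measurable (cone_measure n)"
      using measurable_compose[OF measurable_cone assms] by (simp add: split_beta')
    then have "(\<lambda>p. F (case_nat (fst p) (snd p)) * indicator (cone_set n) p)
      \<in> borel_measurable (LI \<Otimes>\<^sub>M simplex_measure n)"
      unfolding cone_measure_def using cone_set_sets
      by (subst (asm) borel_measurable_restrict_space_iff_ennreal) auto
    from LI_simplex.nn_integral_snd[OF this[unfolded split_beta']] show ?thesis by simp
  qed
  also have "\<dots> = (\<integral>\<^sup>+ p. F (case_nat (fst p) (snd p)) \<partial>cone_measure n)"
    unfolding cone_measure_def by (rule nn_integral_restrict_space[symmetric]) (rule cone_set_sets)
  finally show ?thesis .
qed

lemma distr_cone:
  "distr (cone_measure n) (simplex_measure (Suc n)) (\<lambda>(u, t). case_nat u t) = simplex_measure (Suc n)"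
proof (rule measure_eqI)
  fix A assume "A \<in> sets (distr (cone_measure n) (simplex_measure (Suc n)) (\<lambda>(u, t). case_nat u t))"
  then have A: "A \<in> sets (simplex_measure (Suc n))" by simp
  let ?D = "distr (cone_measure n) (simplex_measure (Suc n)) (\<lambda>(u, t). case_nat u t)"
  have ind: "indicator A \<in> borel_measurable (simplex_measure (Suc n))"
    using A by (rule borel_measurable_indicator)
  have "emeasure ?D A = (\<integral>\<^sup>+ s. indicator A s \<partial>?D)"
    by (rule nn_integral_indicator[symmetric]) (simp add: A)
  also have "\<dots> = (\<integral>\<^sup>+ p. indicator A (case p of (u, t) \<Rightarrow> case_nat u t) \<partial>cone_measure n)"
    by (rule nn_integral_distr[OF measurable_cone]) (simp add: ind)
  also have "\<dots> = (\<integral>\<^sup>+ s. indicator A s \<partial>simplex_measure (Suc n))"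
    unfolding nn_integral_simplex_Suc[OF ind] by (simp add: split_beta')
  also have "\<dots> = emeasure (simplex_measure (Suc n)) A"
    using A by (rule nn_integral_indicator)
  finally show "emeasure ?D A = emeasure (simplex_measure (Suc n)) A" .
qed simp


lemma L2_iff: "g \<in> L2 M \<longleftrightarrow> g \<in> borel_measurable M \<and> (\<integral>\<^sup>+ x. ennreal ((cmod (g x))\<^sup>2) \<partial>M) < \<infinity>"
  unfolding L2_def by (auto simp: integrable_iff_bounded)

lemma measurable_cnj [measurable (raw)]:
  "f \<in> borel_measurable M \<Longrightarrow> (\<lambda>x. cnj (f x)) \<in> borel_measurable M"
  by (rule borel_measurable_continuous_on[of cnj]) (intro continuous_intros)

lemma L2_prod_integrable:
  assumes "f \<in> L2 M" "g \<in> L2 M"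
  shows "integrable M (\<lambda>x. cnj (f x) * g x)" "integrable M (\<lambda>x. cmod (f x) * cmod (g x))"
proof -
  have [measurable]: "f \<in> borel_measurable M" "g \<in> borel_measurable M"
    and i: "integrable M (\<lambda>x. (cmod (f x))\<^sup>2 + (cmod (g x))\<^sup>2)"
    using assms by (auto simp: L2_def)
  have le: "a * b \<le> a\<^sup>2 + b\<^sup>2" if "0 \<le> a" "0 \<le> b" for a b :: real
  proof -
    have "2 * (a * b) \<le> a\<^sup>2 + b\<^sup>2" using sum_squares_bound[of a b] by simp
    with that show ?thesis by (smt (verit) mult_nonneg_nonneg)
  qed
  show "integrable M (\<lambda>x. cnj (f x) * g x)"
    by (rule Bochner_Integration.integrable_bound[OF i]) (auto simp: norm_mult intro!: le)
  show "integrable M (\<lambda>x. cmod (f x) * cmod (g x))"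
    by (rule Bochner_Integration.integrable_bound[OF i]) (auto intro!: le)
qed

lemma L2_Cauchy_Schwarz:
  assumes "f \<in> L2 M" "g \<in> L2 M"
  shows "(cmod (\<integral>x. cnj (f x) * g x \<partial>M))\<^sup>2 \<le> (\<integral>x. (cmod (f x))\<^sup>2 \<partial>M) * (\<integral>x. (cmod (g x))\<^sup>2 \<partial>M)"
proof -
  define A B c where "A = (\<integral>x. (cmod (f x))\<^sup>2 \<partial>M)" and "B = (\<integral>x. (cmod (g x))\<^sup>2 \<partial>M)"
    and "c = (\<integral>x. cmod (f x) * cmod (g x) \<partial>M)"
  have int: "integrable M (\<lambda>x. (cmod (f x))\<^sup>2)" "integrable M (\<lambda>x. (cmod (g x))\<^sup>2)"
    using assms by (auto simp: L2_def)
  have c0: "0 \<le> c" and B0: "0 \<le> B" unfolding c_def B_def by simp_all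
  have q: "0 \<le> A - 2 * r * c + r\<^sup>2 * B" for r
  proof -
    have "0 \<le> (\<integral>x. (cmod (f x) - r * cmod (g x))\<^sup>2 \<partial>M)" by simp
    also have "\<dots> = (\<integral>x. (cmod (f x))\<^sup>2 - (2 * r) * (cmod (f x) * cmod (g x)) + r\<^sup>2 * (cmod (g x))\<^sup>2 \<partial>M)"
      by (simp add: power2_diff power_mult_distrib algebra_simps)
    also have "\<dots> = A - 2 * r * c + r\<^sup>2 * B"
      unfolding A_def B_def c_def using int L2_prod_integrable(2)[OF assms] by simp
    finally show ?thesis .
  qed
  have "c\<^sup>2 \<le> A * B"
  proof (cases "B = 0")
    case True
    have "c = 0"
    proof (rule ccontr)
      assume "c \<noteq> 0"
      with q[of "(A + 1) / (2 * c)"] True show False by (simp add: field_simps)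
    qed
    with True show ?thesis by simp
  next
    case False
    with B0 have "B > 0" by simp
    with q[of "c / B"] have "0 \<le> A - c\<^sup>2 / B"
      by (simp add: power2_eq_square field_simps)
    with \<open>B > 0\<close> show ?thesis by (simp add: field_simps)
  qed
  moreover have "cmod (\<integral>x. cnj (f x) * g x \<partial>M) \<le> c"
    unfolding c_def using integral_norm_bound[of M "\<lambda>x. cnj (f x) * g x"] by (simp add: norm_mult)
  ultimately show ?thesis
    using power_mono[of "cmod (\<integral>x. cnj (f x) * g x \<partial>M)" c 2] unfolding A_def B_def by simp
qed

lemma measurable_fst_cone: "f \<in> borel_measurable LI \<Longrightarrow> (\<lambda>p. f (fst p)) \<in> borel_measurable (cone_measure n)"
  unfolding cone_measure_def by (rule measurable_restrict_space1, rule measurable_compose[OF measurable_fst])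

lemma measurable_snd_cone:
  "g \<in> borel_measurable (simplex_measure n) \<Longrightarrow> (\<lambda>p. g (snd p)) \<in> borel_measurable (cone_measure n)"
  unfolding cone_measure_def by (rule measurable_restrict_space1, rule measurable_compose[OF measurable_snd])

lemma measurable_ccreate:
  assumes f: "f \<in> borel_measurable LI" and g: "g n \<in> borel_measurable (simplex_measure n)"
  shows "ccreate f g (Suc n) \<in> borel_measurable (simplex_measure (Suc n))"
proof -
  have "(\<lambda>t. f (t 0)) \<in> borel_measurable (simplex_measure (Suc n))"
    by (rule measurable_compose[OF measurable_simplex_component f]) simp
  moreover have "(\<lambda>t. g n (\<lambda>i. t (Suc i))) \<in> borel_measurable (simplex_measure (Suc n))"
    by (rule measurable_compose[OF measurable_simplex_shift g])
  ultimately show ?thesis by (simp add: ccreate_def)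
qed

lemma nn_integral_cone:
  assumes "F \<in> borel_measurable (cone_measure n)"
  shows "(\<integral>\<^sup>+ p. F p \<partial>cone_measure n) =
    (\<integral>\<^sup>+ t. \<integral>\<^sup>+ u. F (u, t) * indicator (cone_set n) (u, t) \<partial>LI \<partial>simplex_measure n)"
proof -
  have "(\<lambda>p. F p * indicator (cone_set n) p) \<in> borel_measurable (LI \<Otimes>\<^sub>M simplex_measure n)"
    using assms unfolding cone_measure_def
    by (subst (asm) borel_measurable_restrict_space_iff_ennreal[OF cone_set_sets])
  moreover have "(\<integral>\<^sup>+ p. F p \<partial>cone_measure n) =
      (\<integral>\<^sup>+ p. F p * indicator (cone_set n) p \<partial>(LI \<Otimes>\<^sub>M simplex_measure n))"
    unfolding cone_measure_def by (rule nn_integral_restrict_space[OF cone_set_sets])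
  ultimately show ?thesis
    using LI_simplex.nn_integral_snd[of "\<lambda>p. F p * indicator (cone_set n) p"] by simp
qed

lemma nn_integral_ccreate:
  assumes f: "f \<in> borel_measurable LI" and g: "g n \<in> borel_measurable (simplex_measure n)"
  shows "(\<integral>\<^sup>+ s. ennreal ((cmod (ccreate f g (Suc n) s))\<^sup>2) \<partial>simplex_measure (Suc n)) \<le>
    (\<integral>\<^sup>+ u. ennreal ((cmod (f u))\<^sup>2) \<partial>LI) * (\<integral>\<^sup>+ t. ennreal ((cmod (g n t))\<^sup>2) \<partial>simplex_measure n)"
proof -
  have [measurable]: "ccreate f g (Suc n) \<in> borel_measurable (simplex_measure (Suc n))"
    using f g by (rule measurable_ccreate)
  note [measurable] = measurable_fst_cone[OF f] measurable_snd_cone[of "g n" n, OF g]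
  note [measurable] = f g
  have "(\<integral>\<^sup>+ s. ennreal ((cmod (ccreate f g (Suc n) s))\<^sup>2) \<partial>simplex_measure (Suc n)) =
    (\<integral>\<^sup>+ p. ennreal ((cmod (f (fst p)))\<^sup>2) * ennreal ((cmod (g n (snd p)))\<^sup>2) \<partial>cone_measure n)"
  proof (subst nn_integral_simplex_Suc)
    show "(\<lambda>s. ennreal ((cmod (ccreate f g (Suc n) s))\<^sup>2)) \<in> borel_measurable (simplex_measure (Suc n))"
      by measurable
  qed (simp add: ccreate_def norm_mult power_mult_distrib ennreal_mult)
  also have "\<dots> = (\<integral>\<^sup>+ t. \<integral>\<^sup>+ u. ennreal ((cmod (f u))\<^sup>2) * ennreal ((cmod (g n t))\<^sup>2) *
      indicator (cone_set n) (u, t) \<partial>LI \<partial>simplex_measure n)"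
  proof (subst nn_integral_cone)
    show "(\<lambda>p. ennreal ((cmod (f (fst p)))\<^sup>2) * ennreal ((cmod (g n (snd p)))\<^sup>2)) \<in>
        borel_measurable (cone_measure n)"
      by measurable
  qed simp
  also have "\<dots> \<le> (\<integral>\<^sup>+ t. \<integral>\<^sup>+ u. ennreal ((cmod (f u))\<^sup>2) * ennreal ((cmod (g n t))\<^sup>2)
      \<partial>LI \<partial>simplex_measure n)"
    by (intro nn_integral_mono) (simp add: indicator_def)
  also have "\<dots> = (\<integral>\<^sup>+ u. ennreal ((cmod (f u))\<^sup>2) \<partial>LI) *
      (\<integral>\<^sup>+ t. ennreal ((cmod (g n t))\<^sup>2) \<partial>simplex_measure n)"
  proof -
    have "(\<lambda>u. ennreal ((cmod (f u))\<^sup>2)) \<in> borel_measurable LI"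
      and "(\<lambda>t. ennreal ((cmod (g n t))\<^sup>2)) \<in> borel_measurable (simplex_measure n)"
      by measurable
    then show ?thesis by (simp only: nn_integral_multc nn_integral_cmult)
  qed
  finally show ?thesis .
qed

lemma L2_ccreate:
  assumes f: "f \<in> L2 LI" and g: "g n \<in> L2 (simplex_measure n)"
  shows "ccreate f g (Suc n) \<in> L2 (simplex_measure (Suc n))"
    "(\<integral>s. (cmod (ccreate f g (Suc n) s))\<^sup>2 \<partial>simplex_measure (Suc n)) \<le>
       (\<integral>u. (cmod (f u))\<^sup>2 \<partial>LI) * (\<integral>t. (cmod (g n t))\<^sup>2 \<partial>simplex_measure n)"
proof -
  have m: "f \<in> borel_measurable LI" "g n \<in> borel_measurable (simplex_measure n)"
    and i: "integrable LI (\<lambda>u. (cmod (f u))\<^sup>2)" "integrable (simplex_measure n) (\<lambda>t. (cmod (g n t))\<^sup>2)"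
    using f g by (auto simp: L2_def)
  have le: "(\<integral>\<^sup>+ s. ennreal ((cmod (ccreate f g (Suc n) s))\<^sup>2) \<partial>simplex_measure (Suc n)) \<le>
     ennreal ((\<integral>u. (cmod (f u))\<^sup>2 \<partial>LI) * (\<integral>t. (cmod (g n t))\<^sup>2 \<partial>simplex_measure n))"
    using nn_integral_ccreate[of f g n, OF m] i by (simp add: nn_integral_eq_integral ennreal_mult)
  then show L2: "ccreate f g (Suc n) \<in> L2 (simplex_measure (Suc n))"
    using measurable_ccreate[of f g n, OF m] by (auto simp: L2_iff intro: le_less_trans)
  show "(\<integral>s. (cmod (ccreate f g (Suc n) s))\<^sup>2 \<partial>simplex_measure (Suc n)) \<le>
       (\<integral>u. (cmod (f u))\<^sup>2 \<partial>LI) * (\<integral>t. (cmod (g n t))\<^sup>2 \<partial>simplex_measure n)"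
    using le L2 by (simp add: L2_def nn_integral_eq_integral)
qed

lemma ccreate_in_cfock:
  assumes f: "f \<in> L2 LI" and g: "g \<in> cfock"
  shows "ccreate f g \<in> cfock"
proof -
  have gn: "g n \<in> L2 (simplex_measure n)" for n using g by (simp add: cfock_def)
  have "summable (\<lambda>n. (\<integral>u. (cmod (f u))\<^sup>2 \<partial>LI) * (\<integral>t. (cmod (g n t))\<^sup>2 \<partial>simplex_measure n))"
    using g by (intro summable_mult) (simp add: cfock_def)
  then have "summable (\<lambda>n. \<integral>s. (cmod (ccreate f g (Suc n) s))\<^sup>2 \<partial>simplex_measure (Suc n))"
    by (rule summable_comparison_test') (use L2_ccreate(2)[of f g, OF f gn] in simp)
  then have "summable (\<lambda>n. \<integral>s. (cmod (ccreate f g n s))\<^sup>2 \<partial>simplex_measure n)"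
    by (subst summable_Suc_iff[symmetric])
  moreover have "ccreate f g n \<in> L2 (simplex_measure n)" for n
    by (cases n) (use L2_ccreate(1)[of f g, OF f gn] in \<open>simp_all add: ccreate_def L2_def\<close>)
  ultimately show ?thesis by (simp add: cfock_def)
qed

lemma cannihilate_alt:
  "cannihilate f g n t = (\<integral>u. indicator (cone_set n) (u, t) *\<^sub>R (cnj (f u) * g (Suc n) (case_nat u t)) \<partial>LI)"
  unfolding cannihilate_def set_lebesgue_integral_def cone_set_def
  by (intro Bochner_Integration.integral_cong refl) (simp add: indicator_def)

lemma measurable_cone_indicator:
  fixes F :: "_ \<Rightarrow> 'b::real_normed_vector"
  assumes "F \<in> borel_measurable (cone_measure n)"
  shows "(\<lambda>p. indicator (cone_set n) p *\<^sub>R F p) \<in> borel_measurable (LI \<Otimes>\<^sub>M simplex_measure n)"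
  using assms unfolding cone_measure_def
  by (subst (asm) borel_measurable_restrict_space_iff[OF cone_set_sets])

lemma measurable_cone_compose:
  "G \<in> borel_measurable (simplex_measure (Suc n)) \<Longrightarrow>
    (\<lambda>p. G (case_nat (fst p) (snd p))) \<in> borel_measurable (cone_measure n)"
  using measurable_compose[OF measurable_cone] by (simp add: split_beta')

lemma measurable_cannihilate:
  assumes f: "f \<in> borel_measurable LI" and g: "g (Suc n) \<in> borel_measurable (simplex_measure (Suc n))"
  shows "cannihilate f g n \<in> borel_measurable (simplex_measure n)"
proof -
  note [measurable] = measurable_fst_cone[OF f] measurable_cone_compose[OF g]
  have "(\<lambda>p. cnj (f (fst p)) * g (Suc n) (case_nat (fst p) (snd p))) \<in> borel_measurable (cone_measure n)"
    by measurable
  from measurable_compose[OF measurable_pair_swap' measurable_cone_indicator[OF this]]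
  have "(\<lambda>(t, u). indicator (cone_set n) (u, t) *\<^sub>R (cnj (f u) * g (Suc n) (case_nat u t)))
    \<in> borel_measurable (simplex_measure n \<Otimes>\<^sub>M LI)"
    by (simp add: split_beta')
  from LI.borel_measurable_lebesgue_integral[OF this] show ?thesis
    by (simp add: cannihilate_alt[abs_def])
qed

lemma nn_integral_cannihilate:
  assumes f: "f \<in> L2 LI" and g: "g (Suc n) \<in> L2 (simplex_measure (Suc n))"
  shows "(\<integral>\<^sup>+ t. ennreal ((cmod (cannihilate f g n t))\<^sup>2) \<partial>simplex_measure n) \<le>
    (\<integral>\<^sup>+ u. ennreal ((cmod (f u))\<^sup>2) \<partial>LI) *
    (\<integral>\<^sup>+ s. ennreal ((cmod (g (Suc n) s))\<^sup>2) \<partial>simplex_measure (Suc n))"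
proof -
  have fm: "f \<in> borel_measurable LI" and gm: "g (Suc n) \<in> borel_measurable (simplex_measure (Suc n))"
    and fi: "integrable LI (\<lambda>u. (cmod (f u))\<^sup>2)"
    using f g by (auto simp: L2_def)
  define G where "G = (\<lambda>u t. indicator (cone_set n) (u, t) *\<^sub>R g (Suc n) (case_nat u t))"
  have "(\<lambda>p. G (fst p) (snd p)) \<in> borel_measurable (LI \<Otimes>\<^sub>M simplex_measure n)"
    using measurable_cone_indicator[OF measurable_cone_compose[OF gm]] by (simp add: G_def)
  then have Gm: "(\<lambda>(u, t). G u t) \<in> borel_measurable (LI \<Otimes>\<^sub>M simplex_measure n)"
    by (simp add: split_beta')
  then have Gm2: "(\<lambda>(u, t). ennreal ((cmod (G u t))\<^sup>2)) \<in> borel_measurable (LI \<Otimes>\<^sub>M simplex_measure n)"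
    by measurable
  have "(\<integral>\<^sup>+ s. ennreal ((cmod (g (Suc n) s))\<^sup>2) \<partial>simplex_measure (Suc n)) =
      (\<integral>\<^sup>+ p. ennreal ((cmod (g (Suc n) (case_nat (fst p) (snd p))))\<^sup>2) \<partial>cone_measure n)"
    using gm by (subst nn_integral_simplex_Suc) simp_all
  also have "\<dots> = (\<integral>\<^sup>+ t. \<integral>\<^sup>+ u. ennreal ((cmod (g (Suc n) (case_nat u t)))\<^sup>2) *
      indicator (cone_set n) (u, t) \<partial>LI \<partial>simplex_measure n)"
    using measurable_cone_compose[OF gm] by (subst nn_integral_cone) simp_all
  also have "\<dots> = (\<integral>\<^sup>+ t. \<integral>\<^sup>+ u. ennreal ((cmod (G u t))\<^sup>2) \<partial>LI \<partial>simplex_measure n)"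
    by (intro nn_integral_cong) (simp add: G_def indicator_def)
  finally have eq: "(\<integral>\<^sup>+ s. ennreal ((cmod (g (Suc n) s))\<^sup>2) \<partial>simplex_measure (Suc n)) =
      (\<integral>\<^sup>+ t. \<integral>\<^sup>+ u. ennreal ((cmod (G u t))\<^sup>2) \<partial>LI \<partial>simplex_measure n)" .
  have Hm: "(\<lambda>t. \<integral>\<^sup>+ u. ennreal ((cmod (G u t))\<^sup>2) \<partial>LI) \<in> borel_measurable (simplex_measure n)"
    using measurable_compose[OF measurable_pair_swap' Gm2]
    by (intro LI.borel_measurable_nn_integral) (simp add: split_beta')
  have fin: "AE t in simplex_measure n. (\<integral>\<^sup>+ u. ennreal ((cmod (G u t))\<^sup>2) \<partial>LI) \<noteq> \<infinity>"
    using g eq by (intro nn_integral_PInf_AE[OF Hm]) (auto simp: L2_iff)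
  have "(\<integral>\<^sup>+ t. ennreal ((cmod (cannihilate f g n t))\<^sup>2) \<partial>simplex_measure n) \<le>
    (\<integral>\<^sup>+ t. (\<integral>\<^sup>+ u. ennreal ((cmod (f u))\<^sup>2) \<partial>LI) * (\<integral>\<^sup>+ u. ennreal ((cmod (G u t))\<^sup>2) \<partial>LI)
      \<partial>simplex_measure n)"
  proof (rule nn_integral_mono_AE, use fin AE_space in eventually_elim)
    fix t assume fin: "(\<integral>\<^sup>+ u. ennreal ((cmod (G u t))\<^sup>2) \<partial>LI) \<noteq> \<infinity>"
      and t: "t \<in> space (simplex_measure n)"
    have "(\<lambda>u. G u t) \<in> borel_measurable LI"
      using measurable_compose[OF measurable_Pair2'[OF t] Gm] by simp
    with fin have GL: "(\<lambda>u. G u t) \<in> L2 LI" by (simp add: L2_iff less_top)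
    have "cannihilate f g n t = (\<integral>u. cnj (f u) * G u t \<partial>LI)"
      unfolding cannihilate_alt by (intro Bochner_Integration.integral_cong) (auto simp: G_def)
    then have "(cmod (cannihilate f g n t))\<^sup>2 \<le>
        (\<integral>u. (cmod (f u))\<^sup>2 \<partial>LI) * (\<integral>u. (cmod (G u t))\<^sup>2 \<partial>LI)"
      using L2_Cauchy_Schwarz[OF f GL] by simp
    then show "ennreal ((cmod (cannihilate f g n t))\<^sup>2) \<le>
        (\<integral>\<^sup>+ u. ennreal ((cmod (f u))\<^sup>2) \<partial>LI) * (\<integral>\<^sup>+ u. ennreal ((cmod (G u t))\<^sup>2) \<partial>LI)"
      using fi GL by (simp add: L2_def nn_integral_eq_integral ennreal_mult[symmetric] ennreal_leI)
  qed
  also have "\<dots> = (\<integral>\<^sup>+ u. ennreal ((cmod (f u))\<^sup>2) \<partial>LI) *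
      (\<integral>\<^sup>+ s. ennreal ((cmod (g (Suc n) s))\<^sup>2) \<partial>simplex_measure (Suc n))"
    unfolding eq by (rule nn_integral_cmult[OF Hm])
  finally show ?thesis .
qed

lemma L2_cannihilate:
  assumes f: "f \<in> L2 LI" and g: "g (Suc n) \<in> L2 (simplex_measure (Suc n))"
  shows "cannihilate f g n \<in> L2 (simplex_measure n)"
    "(\<integral>t. (cmod (cannihilate f g n t))\<^sup>2 \<partial>simplex_measure n) \<le>
       (\<integral>u. (cmod (f u))\<^sup>2 \<partial>LI) * (\<integral>s. (cmod (g (Suc n) s))\<^sup>2 \<partial>simplex_measure (Suc n))"
proof -
  have m: "f \<in> borel_measurable LI" "g (Suc n) \<in> borel_measurable (simplex_measure (Suc n))"
    and i: "integrable LI (\<lambda>u. (cmod (f u))\<^sup>2)"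
      "integrable (simplex_measure (Suc n)) (\<lambda>t. (cmod (g (Suc n) t))\<^sup>2)"
    using f g by (auto simp: L2_def)
  have le: "(\<integral>\<^sup>+ t. ennreal ((cmod (cannihilate f g n t))\<^sup>2) \<partial>simplex_measure n) \<le>
     ennreal ((\<integral>u. (cmod (f u))\<^sup>2 \<partial>LI) * (\<integral>s. (cmod (g (Suc n) s))\<^sup>2 \<partial>simplex_measure (Suc n)))"
    using nn_integral_cannihilate[of f g n, OF f g] i by (simp add: nn_integral_eq_integral ennreal_mult)
  then show L2: "cannihilate f g n \<in> L2 (simplex_measure n)"
    using measurable_cannihilate[of f g n, OF m] by (auto simp: L2_iff intro: le_less_trans)
  show "(\<integral>t. (cmod (cannihilate f g n t))\<^sup>2 \<partial>simplex_measure n) \<le>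
       (\<integral>u. (cmod (f u))\<^sup>2 \<partial>LI) * (\<integral>s. (cmod (g (Suc n) s))\<^sup>2 \<partial>simplex_measure (Suc n))"
    using le L2 by (simp add: L2_def nn_integral_eq_integral)
qed

lemma cannihilate_in_cfock:
  assumes f: "f \<in> L2 LI" and g: "g \<in> cfock"
  shows "cannihilate f g \<in> cfock"
proof -
  have gn: "g n \<in> L2 (simplex_measure n)" for n using g by (simp add: cfock_def)
  have "summable (\<lambda>n. \<integral>t. (cmod (g (Suc n) t))\<^sup>2 \<partial>simplex_measure (Suc n))"
    using g by (subst summable_Suc_iff) (simp add: cfock_def)
  then have "summable (\<lambda>n. (\<integral>u. (cmod (f u))\<^sup>2 \<partial>LI) * (\<integral>t. (cmod (g (Suc n) t))\<^sup>2 \<partial>simplex_measure (Suc n)))"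
    by (rule summable_mult)
  then have "summable (\<lambda>n. \<integral>t. (cmod (cannihilate f g n t))\<^sup>2 \<partial>simplex_measure n)"
    by (rule summable_comparison_test') (use L2_cannihilate(2)[of f g, OF f gn] in simp)
  then show ?thesis
    using L2_cannihilate(1)[of f g, OF f gn] by (simp add: cfock_def)
qed

lemma cinner_cannihilate_term:
  assumes f: "f \<in> L2 LI" and g: "g (Suc n) \<in> L2 (simplex_measure (Suc n))"
    and h: "h n \<in> L2 (simplex_measure n)"
  shows "(\<integral>t. cnj (cannihilate f g n t) * h n t \<partial>simplex_measure n) =
    (\<integral>s. cnj (g (Suc n) s) * ccreate f h (Suc n) s \<partial>simplex_measure (Suc n))"
proof -
  define F where "F = (\<lambda>s. cnj (g (Suc n) s) * ccreate f h (Suc n) s)"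
  have Fi: "integrable (simplex_measure (Suc n)) F"
    unfolding F_def by (rule L2_prod_integrable(1)[OF g L2_ccreate(1)[of f h n, OF f h]])
  have Fd: "F (case_nat u t) = cnj (cnj (f u) * g (Suc n) (case_nat u t)) * h n t" for u t
    by (simp add: F_def ccreate_def)
  have "integrable (distr (cone_measure n) (simplex_measure (Suc n)) (\<lambda>(u, t). case_nat u t)) F"
    using Fi by (simp add: distr_cone)
  from integrable_distr[OF measurable_cone this]
  have "integrable (cone_measure n) (\<lambda>p. F (case p of (u, t) \<Rightarrow> case_nat u t))" .
  then have ci: "integrable (LI \<Otimes>\<^sub>M simplex_measure n)
      (\<lambda>p. indicator (cone_set n) p *\<^sub>R F (case p of (u, t) \<Rightarrow> case_nat u t))"
    unfolding cone_measure_def by (subst (asm) integrable_restrict_space[OF cone_set_sets])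
  have "integral\<^sup>L (simplex_measure (Suc n)) F =
      (\<integral>p. F (case p of (u, t) \<Rightarrow> case_nat u t) \<partial>cone_measure n)"
    by (subst distr_cone[symmetric], rule integral_distr[OF measurable_cone]) (rule borel_measurable_integrable[OF Fi])
  also have "\<dots> = (\<integral>p. indicator (cone_set n) p *\<^sub>R F (case p of (u, t) \<Rightarrow> case_nat u t)
      \<partial>(LI \<Otimes>\<^sub>M simplex_measure n))"
    unfolding cone_measure_def by (rule integral_restrict_space[OF cone_set_sets])
  also have "\<dots> = (\<integral>t. \<integral>u. indicator (cone_set n) (u, t) *\<^sub>R F (case_nat u t) \<partial>LI \<partial>simplex_measure n)"
    using LI_simplex.integral_snd[where f = "\<lambda>u t. indicator (cone_set n) (u, t) *\<^sub>R F (case_nat u t)"] ci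
    by (simp add: split_beta')
  also have "\<dots> = (\<integral>t. cnj (cannihilate f g n t) * h n t \<partial>simplex_measure n)"
  proof (intro Bochner_Integration.integral_cong refl)
    fix t
    have "(\<integral>u. indicator (cone_set n) (u, t) *\<^sub>R F (case_nat u t) \<partial>LI) =
      (\<integral>u. cnj (indicator (cone_set n) (u, t) *\<^sub>R (cnj (f u) * g (Suc n) (case_nat u t))) * h n t \<partial>LI)"
      by (intro Bochner_Integration.integral_cong refl) (simp add: Fd)
    also have "\<dots> = (\<integral>u. cnj (indicator (cone_set n) (u, t) *\<^sub>R (cnj (f u) * g (Suc n) (case_nat u t))) \<partial>LI) * h n t"
      by (rule integral_mult_left_zero)
    also have "\<dots> = cnj (cannihilate f g n t) * h n t"
      unfolding cannihilate_alt by (simp only: Bochner_Integration.integral_cnj)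
    finally show "(\<integral>u. indicator (cone_set n) (u, t) *\<^sub>R F (case_nat u t) \<partial>LI) =
      cnj (cannihilate f g n t) * h n t" .
  qed
  finally show ?thesis by (simp add: F_def)
qed

lemma summable_cinner:
  assumes "g \<in> cfock" "h \<in> cfock"
  shows "summable (\<lambda>n. \<integral>t. cnj (g n t) * h n t \<partial>simplex_measure n)"
proof -
  define A B where "A = (\<lambda>n. \<integral>t. (cmod (g n t))\<^sup>2 \<partial>simplex_measure n)"
    and "B = (\<lambda>n. \<integral>t. (cmod (h n t))\<^sup>2 \<partial>simplex_measure n)"
  have "summable (\<lambda>n. A n + B n)"
    using assms by (intro summable_add) (simp_all add: cfock_def A_def B_def)
  moreover have "cmod (\<integral>t. cnj (g n t) * h n t \<partial>simplex_measure n) \<le> A n + B n" for n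
  proof -
    have "(cmod (\<integral>t. cnj (g n t) * h n t \<partial>simplex_measure n))\<^sup>2 \<le> A n * B n"
      using assms unfolding A_def B_def by (intro L2_Cauchy_Schwarz) (simp_all add: cfock_def)
    also have "\<dots> \<le> (A n + B n)\<^sup>2"
      by (simp add: A_def B_def power2_eq_square algebra_simps)
    finally show ?thesis
      by (rule power2_le_imp_le) (simp add: A_def B_def)
  qed
  ultimately show ?thesis by (rule summable_comparison_test')
qed

lemma cinner_cannihilate:
  assumes f: "f \<in> L2 LI" and g: "g \<in> cfock" and h: "h \<in> cfock"
  shows "cinner (cannihilate f g) h = cinner g (ccreate f h)"
proof -
  have "cinner g (ccreate f h) =
      (\<Sum>n. \<integral>s. cnj (g (Suc n) s) * ccreate f h (Suc n) s \<partial>simplex_measure (Suc n))"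
    unfolding cinner_def
    by (subst suminf_split_head[OF summable_cinner[OF g ccreate_in_cfock[OF f h]]])
       (simp add: ccreate_def)
  also have "\<dots> = cinner (cannihilate f g) h"
    unfolding cinner_def using g h
    by (intro suminf_cong cinner_cannihilate_term[symmetric] f) (simp_all add: cfock_def)
  finally show ?thesis ..
qed

lemma L2_diff:
  assumes "f \<in> L2 M" "g \<in> L2 M"
  shows "(\<lambda>x. f x - g x) \<in> L2 M"
proof -
  have [measurable]: "f \<in> borel_measurable M" "g \<in> borel_measurable M"
    and i: "integrable M (\<lambda>x. 2 * (cmod (f x))\<^sup>2 + 2 * (cmod (g x))\<^sup>2)"
    using assms by (auto simp: L2_def)
  have le: "(cmod (a - b))\<^sup>2 \<le> 2 * (cmod a)\<^sup>2 + 2 * (cmod b)\<^sup>2" for a b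
  proof -
    have "(cmod (a - b))\<^sup>2 \<le> (cmod a + cmod b)\<^sup>2"
      by (intro power_mono norm_triangle_ineq4) simp
    also have "\<dots> \<le> 2 * (cmod a)\<^sup>2 + 2 * (cmod b)\<^sup>2"
      using sum_squares_bound[of "cmod a" "cmod b"] by (simp add: power2_sum)
    finally show ?thesis .
  qed
  have m: "(\<lambda>x. f x - g x) \<in> borel_measurable M" by measurable
  have "integrable M (\<lambda>x. (cmod (f x - g x))\<^sup>2)"
    by (rule Bochner_Integration.integrable_bound[OF i]) (measurable, simp add: le)
  with m show ?thesis by (simp add: L2_def)
qed

lemma ccreate_cong:
  assumes f: "f \<in> L2 LI" and g: "g \<in> cfock" "g' \<in> cfock" and eq: "cfock_eq g g'"
  shows "cfock_eq (ccreate f g) (ccreate f g')"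
  unfolding cfock_eq_def
proof
  fix n
  have gn: "g k \<in> L2 (simplex_measure k)" "g' k \<in> L2 (simplex_measure k)" for k
    using g by (simp_all add: cfock_def)
  show "AE t in simplex_measure n. ccreate f g n t = ccreate f g' n t"
  proof (cases n)
    case (Suc k)
    define d where "d = (\<lambda>(_::nat) t. g k t - g' k t)"
    have d: "d k \<in> L2 (simplex_measure k)"
      unfolding d_def by (rule L2_diff[OF gn])
    have "AE t in simplex_measure k. (cmod (d k t))\<^sup>2 = 0"
      using eq by (simp add: d_def cfock_eq_def)
    then have "(\<integral>t. (cmod (d k t))\<^sup>2 \<partial>simplex_measure k) = 0"
      by (rule integral_eq_zero_AE)
    moreover have i: "integrable (simplex_measure n) (\<lambda>s. (cmod (ccreate f d n s))\<^sup>2)"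
      using L2_ccreate(1)[of f d k, OF f d] by (simp add: Suc L2_def)
    ultimately have "(\<integral>s. (cmod (ccreate f d n s))\<^sup>2 \<partial>simplex_measure n) = 0"
      using L2_ccreate(2)[of f d k, OF f d] by (intro antisym) (simp_all add: Suc)
    then have "AE s in simplex_measure n. (cmod (ccreate f d n s))\<^sup>2 = 0"
      using i by (subst (asm) integral_nonneg_eq_0_iff_AE) simp_all
    then show ?thesis
      by eventually_elim (simp add: Suc ccreate_def d_def algebra_simps)
  qed (simp add: ccreate_def)
qed

lemma cannihilate_cong:
  assumes f: "f \<in> L2 LI" and g: "g \<in> cfock" "g' \<in> cfock" and eq: "cfock_eq g g'"
  shows "cfock_eq (cannihilate f g) (cannihilate f g')"
  unfolding cfock_eq_def
proof
  fix n
  let ?S = "simplex_measure n" and ?S' = "simplex_measure (Suc n)"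
  have gn: "g (Suc n) \<in> L2 ?S'" "g' (Suc n) \<in> L2 ?S'"
    using g by (simp_all add: cfock_def)
  note a = L2_cannihilate(1)[of f g n, OF f gn(1)] L2_cannihilate(1)[of f g' n, OF f gn(2)]
  define w where "w = (\<lambda>(_::nat) t. cannihilate f g n t - cannihilate f g' n t)"
  have w: "w n \<in> L2 ?S" unfolding w_def by (rule L2_diff[OF a])
  have c: "ccreate f w (Suc n) \<in> L2 ?S'" by (rule L2_ccreate(1)[of f w n, OF f w])
  have "complex_of_real (\<integral>t. (cmod (w n t))\<^sup>2 \<partial>?S) = (\<integral>t. cnj (w n t) * w n t \<partial>?S)"
    unfolding integral_complex_of_real[symmetric]
    by (intro Bochner_Integration.integral_cong refl) (simp only: complex_norm_square mult.commute)
  also have "\<dots> = (\<integral>t. cnj (cannihilate f g n t) * w n t - cnj (cannihilate f g' n t) * w n t \<partial>?S)"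
    by (intro Bochner_Integration.integral_cong refl) (simp add: w_def algebra_simps)
  also have "\<dots> = (\<integral>t. cnj (cannihilate f g n t) * w n t \<partial>?S) - (\<integral>t. cnj (cannihilate f g' n t) * w n t \<partial>?S)"
    by (intro Bochner_Integration.integral_diff L2_prod_integrable(1) a w)
  also have "\<dots> = (\<integral>s. cnj (g (Suc n) s) * ccreate f w (Suc n) s \<partial>?S') -
      (\<integral>s. cnj (g' (Suc n) s) * ccreate f w (Suc n) s \<partial>?S')"
    using cinner_cannihilate_term[of f g n w, OF f gn(1) w] cinner_cannihilate_term[of f g' n w, OF f gn(2) w]
    by simp
  also have "(\<integral>s. cnj (g (Suc n) s) * ccreate f w (Suc n) s \<partial>?S') =
      (\<integral>s. cnj (g' (Suc n) s) * ccreate f w (Suc n) s \<partial>?S')"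
  proof (rule integral_cong_AE)
    have "AE s in ?S'. g (Suc n) s = g' (Suc n) s" using eq by (simp add: cfock_eq_def)
    then show "AE s in ?S'. cnj (g (Suc n) s) * ccreate f w (Suc n) s = cnj (g' (Suc n) s) * ccreate f w (Suc n) s"
      by eventually_elim simp
  qed (rule borel_measurable_integrable[OF L2_prod_integrable(1)[OF gn(1) c]],
       rule borel_measurable_integrable[OF L2_prod_integrable(1)[OF gn(2) c]])
  finally have "(\<integral>t. (cmod (w n t))\<^sup>2 \<partial>?S) = 0"
    by (simp only: diff_self of_real_eq_0_iff)
  then have "AE t in ?S. (cmod (w n t))\<^sup>2 = 0"
    using w by (subst (asm) integral_nonneg_eq_0_iff_AE) (simp_all add: L2_def)
  then show "AE t in ?S. cannihilate f g n t = cannihilate f g' n t"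
    by eventually_elim (simp add: w_def)
qed

lemma simplex_measure_0: "simplex_measure 0 = count_space {\<lambda>_. undefined}"
  by (simp add: simplex_measure_def incr_simplex_def PiM_empty restrict_count_space strict_mono_on_def)

lemma cvacuum_in_cfock: "cvacuum \<in> cfock"
proof -
  have "summable (\<lambda>n. \<integral>t. (cmod (cvacuum n t))\<^sup>2 \<partial>simplex_measure n)"
    by (rule summable_finite[of "{0}"]) (auto simp: cvacuum_def)
  then show ?thesis by (auto simp: cfock_def L2_def cvacuum_def)
qed

lemma cinner_cvacuum: "cinner cvacuum g = g 0 (\<lambda>_. undefined)"
proof -
  have "cinner cvacuum g = (\<Sum>n\<in>{0}. \<integral>t. cnj (cvacuum n t) * g n t \<partial>simplex_measure n)"
    unfolding cinner_def by (rule suminf_finite) (auto simp: cvacuum_def)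
  also have "\<dots> = g 0 (\<lambda>_. undefined)"
    by (simp add: cvacuum_def simplex_measure_0 lebesgue_integral_count_space_finite)
  finally show ?thesis .
qed

lemma riemann_integrable_01_imp_integrable_on:
  assumes "riemann_integrable_01 f" shows "f integrable_on {0..1}"
proof -
  obtain I where I: "\<And>e. e > 0 \<Longrightarrow> \<exists>d>0. \<forall>p. p tagged_division_of {0..1} \<and>
      (\<forall>(x, K)\<in>p. diameter K < d) \<longrightarrow> cmod ((\<Sum>(x, K)\<in>p. measure lborel K *\<^sub>R f x) - I) < e"
    using assms unfolding riemann_integrable_01_def by blast
  have "(f has_integral I) {0..1}"
    unfolding has_integral_real
  proof (intro allI impI)
    fix e :: real assume "e > 0"
    from I[OF this] obtain d where d: "d > 0" "\<And>p. p tagged_division_of {0..1} \<Longrightarrow>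
      (\<forall>(x, K)\<in>p. diameter K < d) \<Longrightarrow> cmod ((\<Sum>(x, K)\<in>p. measure lborel K *\<^sub>R f x) - I) < e"
      by blast
    show "\<exists>\<gamma>. gauge \<gamma> \<and> (\<forall>p. p tagged_division_of {0..1} \<and> \<gamma> fine p \<longrightarrow>
        cmod ((\<Sum>(x, K)\<in>p. measure lborel K *\<^sub>R f x) - I) < e)"
    proof (intro exI[of _ "\<lambda>x. ball x (d / 4)"] conjI allI impI d(2))
      show "gauge (\<lambda>x::real. ball x (d / 4))" using d(1) by (intro gauge_ball) simp
    next
      fix p :: "(real \<times> real set) set"
      assume p: "p tagged_division_of {0..1} \<and> (\<lambda>x. ball x (d / 4)) fine p"
      show "\<forall>(x, K)\<in>p. diameter K < d"
      proof safe
        fix x K assume "(x, K) \<in> p"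
        with p have "K \<subseteq> ball x (d / 4)" by (auto simp: fine_def)
        then have "diameter K \<le> diameter (ball x (d / 4))" by (rule diameter_subset) simp
        with d(1) show "diameter K < d" by (simp add: diameter_ball)
      qed
    qed simp
  qed
  then show ?thesis by (rule has_integral_integrable)
qed

lemma riemann_bounded_01_imp_L2:
  assumes "f \<in> riemann_bounded_01"
  shows "(\<lambda>x. f x * indicator {s..t} x) \<in> L2 LI"
proof -
  from assms obtain B where B: "\<And>x. x \<in> {0..1} \<Longrightarrow> cmod (f x) \<le> B"
    unfolding riemann_bounded_01_def bounded_iff by blast
  have "f \<in> borel_measurable LI"
    using assms riemann_integrable_01_imp_integrable_on
    by (auto simp: riemann_bounded_01_def intro: integrable_imp_measurable)
  moreover have "(indicator {s..t} :: real \<Rightarrow> complex) \<in> borel_measurable LI"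
    by (rule measurable_compose[OF borel_measurable_LI]) simp
  ultimately have m: "(\<lambda>x. f x * indicator {s..t} x) \<in> borel_measurable LI"
    by (rule borel_measurable_times)
  moreover have "integrable LI (\<lambda>x. (cmod (f x * indicator {s..t} x))\<^sup>2)"
  proof (rule LI.integrable_const_bound[where B = "B\<^sup>2"])
    have "(cmod (f x * indicator {s..t} x))\<^sup>2 \<le> B\<^sup>2" if "x \<in> {0..1}" for x
      using B[OF that] by (intro power_mono) (auto simp: indicator_def intro: order_trans[OF norm_ge_zero])
    then show "AE x in LI. norm ((cmod (f x * indicator {s..t} x))\<^sup>2) \<le> B\<^sup>2"
      by (intro AE_I2) simp
    show "(\<lambda>x. (cmod (f x * indicator {s..t} x))\<^sup>2) \<in> borel_measurable LI"
      using m by measurable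
  qed
  ultimately show ?thesis by (simp add: L2_def)
qed

end

theory Submission
  imports Defs
begin

text \<open>Every operator maps elementary tensors to elementary tensors: creation prepends a factor, and
  annihilation integrates the first factor \<open>F\<close> against \<open>cnj f\<close> from 0 up to the first
  remaining coordinate, which multiplies the next factor by the function
  \<open>x \<mapsto> \<integral>\<^bsub>u<x\<^esub> cnj (f u) * F u\<close>; when no factor remains, only a scalar is left. The discrete
  operators do the same with Riemann sums in place of integrals. So it suffices to have a notion of
  approximation of a function by discrete data which is stable under products and indefinite
  integration and under which Riemann sums converge to integrals. The vacuum expectation is the
  degree 0 component of the final vector; the parity of the degree is that of the number of
  operators.\<close>

section \<open>Approximation of functions on grids\<close>

text \<open>Numbered from 1, so that the sampling point k/N of the discrete operators is a tag of
  cell k; closed, as the pieces of a tagged division must be.\<close>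

definition cell :: "nat \<Rightarrow> nat \<Rightarrow> real set" where
  "cell N k = {(real k - 1) / real N .. real k / real N}"

text \<open>The arbitrary tags express at once that \<open>FN\<close> is close to \<open>F\<close> on the grid and that \<open>F\<close> has small
  mean oscillation. Closeness is only required in the mean because \<open>[Ns] + 1 \<le> k\<close> and
  \<open>s \<le> k/N\<close> disagree for \<open>k = Ns\<close>.\<close>

definition approximates :: "(nat \<Rightarrow> nat \<Rightarrow> complex) \<Rightarrow> (real \<Rightarrow> complex) \<Rightarrow> bool" where
  "approximates FN F \<longleftrightarrow> F \<in> borel_measurable LI \<and>
     (\<exists>B. (\<forall>N. \<forall>k\<in>{1..N}. cmod (FN N k) \<le> B) \<and> (\<forall>x\<in>{0..1}. cmod (F x) \<le> B)) \<and>
     (\<forall>e>0. \<forall>\<^sub>F N in sequentially. \<forall>x. (\<forall>k\<in>{1..N}. x k \<in> cell N k) \<longrightarrow>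
        (\<Sum>k=1..N. cmod (FN N k - F (x k))) / real N < e)"

lemma approximatesD:
  assumes "approximates FN F" "e > 0"
  shows "\<forall>\<^sub>F N in sequentially. \<forall>x. (\<forall>k\<in>{1..N}. x k \<in> cell N k) \<longrightarrow>
        (\<Sum>k=1..N. cmod (FN N k - F (x k))) / real N < e"
  using assms unfolding approximates_def by blast

lemma approximates_measurable: "approximates FN F \<Longrightarrow> F \<in> borel_measurable LI"
  by (simp add: approximates_def)

text \<open>A strictly positive common bound, so that tolerances may be divided by it.\<close>

lemma approximates_bound:
  assumes "approximates FN F"
  shows "\<exists>B>0. (\<forall>N. \<forall>k\<in>{1..N}. cmod (FN N k) \<le> B) \<and> (\<forall>x\<in>{0..1}. cmod (F x) \<le> B)"
proof -
  obtain B where B: "\<forall>N. \<forall>k\<in>{1..N}. cmod (FN N k) \<le> B" "\<forall>x\<in>{0..1}. cmod (F x) \<le> B"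
    using assms unfolding approximates_def by blast
  have "\<forall>N. \<forall>k\<in>{1..N}. cmod (FN N k) \<le> \<bar>B\<bar> + 1" "\<forall>x\<in>{0..1}. cmod (F x) \<le> \<bar>B\<bar> + 1"
    using B by (meson order_trans abs_ge_self le_add_same_cancel1 zero_le_one)+
  then show ?thesis by (intro exI[of _ "\<bar>B\<bar> + 1"]) simp
qed

lemma cell_subset:
  assumes "k \<in> {1..N}" shows "cell N k \<subseteq> {0..1}"
proof -
  have "0 \<le> (real k - 1) / real N" "real k / real N \<le> 1"
    using assms by (auto simp: field_simps)
  then show ?thesis by (auto simp: cell_def)
qed

section \<open>Stability under conjugation and products; indicators of intervals\<close>

lemma approximates_zero: "approximates (\<lambda>_ _. 0) (\<lambda>_. 0)"
  unfolding approximates_def by (auto intro: exI[of _ 0])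

lemma approximates_cnj:
  assumes "approximates FN F"
  shows "approximates (\<lambda>N k. cnj (FN N k)) (\<lambda>x. cnj (F x))"
  using assms unfolding approximates_def
  by (simp add: measurable_cnj flip: complex_cnj_diff)

text \<open>Both factors are bounded, so in the splitting GN (FN - F) + F (GN - G) the mean error of
  one factor is weighted by the bound of the other. This dictates the tolerances e / (2 * C) and e /
  (2 * B).\<close>

lemma approximates_mult:
  assumes F: "approximates FN F" and G: "approximates GN G"
  shows "approximates (\<lambda>N k. FN N k * GN N k) (\<lambda>x. F x * G x)"
proof -
  obtain B where B: "B > 0" "\<forall>N. \<forall>k\<in>{1..N}. cmod (FN N k) \<le> B" "\<forall>x\<in>{0..1}. cmod (F x) \<le> B"
    using approximates_bound[OF F] by blast
  obtain C where C: "C > 0" "\<forall>N. \<forall>k\<in>{1..N}. cmod (GN N k) \<le> C" "\<forall>x\<in>{0..1}. cmod (G x) \<le> C"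
    using approximates_bound[OF G] by blast
  show ?thesis
    unfolding approximates_def
  proof (intro conjI exI[of _ "B * C"] allI impI ballI)
    show "(\<lambda>x. F x * G x) \<in> borel_measurable LI"
      using F G by (intro borel_measurable_times approximates_measurable)
    show "cmod (FN N k * GN N k) \<le> B * C" if "k \<in> {1..N}" for N k
      unfolding norm_mult using B C that by (intro mult_mono) (blast intro: less_imp_le norm_ge_zero)+
    show "cmod (F x * G x) \<le> B * C" if "x \<in> {0..1}" for x
      unfolding norm_mult using B C that by (intro mult_mono) (blast intro: less_imp_le norm_ge_zero)+
    fix e :: real assume e: "e > 0"
    have "\<forall>\<^sub>F N in sequentially. \<forall>x. (\<forall>k\<in>{1..N}. x k \<in> cell N k) \<longrightarrow>
        (\<Sum>k=1..N. cmod (FN N k - F (x k))) / real N < e / (2 * C)"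
      by (rule approximatesD[OF F]) (use e C in simp)
    moreover have "\<forall>\<^sub>F N in sequentially. \<forall>x. (\<forall>k\<in>{1..N}. x k \<in> cell N k) \<longrightarrow>
        (\<Sum>k=1..N. cmod (GN N k - G (x k))) / real N < e / (2 * B)"
      by (rule approximatesD[OF G]) (use e B in simp)
    ultimately show "\<forall>\<^sub>F N in sequentially. \<forall>x. (\<forall>k\<in>{1..N}. x k \<in> cell N k) \<longrightarrow>
        (\<Sum>k=1..N. cmod (FN N k * GN N k - F (x k) * G (x k))) / real N < e"
    proof (eventually_elim, intro allI impI)
      fix N and x :: "nat \<Rightarrow> real"
      assume *: "\<forall>x. (\<forall>k\<in>{1..N}. x k \<in> cell N k) \<longrightarrow>
          (\<Sum>k=1..N. cmod (FN N k - F (x k))) / real N < e / (2 * C)"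
        "\<forall>x. (\<forall>k\<in>{1..N}. x k \<in> cell N k) \<longrightarrow>
          (\<Sum>k=1..N. cmod (GN N k - G (x k))) / real N < e / (2 * B)"
        and x: "\<forall>k\<in>{1..N}. x k \<in> cell N k"
      have "cmod (FN N k * GN N k - F (x k) * G (x k)) \<le>
          C * cmod (FN N k - F (x k)) + B * cmod (GN N k - G (x k))" if k: "k \<in> {1..N}" for k
      proof -
        have x01: "x k \<in> {0..1}" using x k cell_subset by blast
        have "FN N k * GN N k - F (x k) * G (x k) =
            GN N k * (FN N k - F (x k)) + F (x k) * (GN N k - G (x k))"
          by (simp add: algebra_simps)
        also have "cmod \<dots> \<le> cmod (GN N k) * cmod (FN N k - F (x k)) + cmod (F (x k)) * cmod (GN N k - G (x k))"
          by (metis norm_mult norm_triangle_ineq)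
        also have "\<dots> \<le> C * cmod (FN N k - F (x k)) + B * cmod (GN N k - G (x k))"
          using B C k x01 by (intro add_mono mult_right_mono norm_ge_zero) blast+
        finally show ?thesis .
      qed
      then have "(\<Sum>k=1..N. cmod (FN N k * GN N k - F (x k) * G (x k))) / real N \<le>
          (\<Sum>k=1..N. C * cmod (FN N k - F (x k)) + B * cmod (GN N k - G (x k))) / real N"
        by (intro divide_right_mono sum_mono) auto
      also have "\<dots> = C * ((\<Sum>k=1..N. cmod (FN N k - F (x k))) / real N) +
          B * ((\<Sum>k=1..N. cmod (GN N k - G (x k))) / real N)"
        by (simp add: sum.distrib sum_distrib_left add_divide_distrib)
      also have "\<dots> < C * (e / (2 * C)) + B * (e / (2 * B))"
        using * x B C by (intro add_strict_mono mult_strict_left_mono) blast+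
      also have "\<dots> = e" using B C by simp
      finally show "(\<Sum>k=1..N. cmod (FN N k * GN N k - F (x k) * G (x k))) / real N < e" .
    qed
  qed
qed

text \<open>Away from the endpoints s and t the two indicators agree for every tag in the cell. At
  most three cells are exceptional, so the mean error is at most 3/N.\<close>

lemma approximates_indicator:
  assumes st: "0 \<le> s" "s \<le> t"
  shows "approximates (\<lambda>N k. indicator {nat \<lfloor>real N * s\<rfloor> + 1 .. nat \<lfloor>real N * t\<rfloor>} k) (indicator {s..t})"
  unfolding approximates_def
proof (intro conjI exI[of _ 1] allI impI ballI)
  show "(indicator {s..t} :: real \<Rightarrow> complex) \<in> borel_measurable LI"
    by (rule measurable_compose[OF borel_measurable_LI]) simp
  fix e :: real assume e: "e > 0"
  show "\<forall>\<^sub>F N in sequentially. \<forall>x. (\<forall>k\<in>{1..N}. x k \<in> cell N k) \<longrightarrow>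
    (\<Sum>k=1..N. cmod (indicator {nat \<lfloor>real N * s\<rfloor> + 1 .. nat \<lfloor>real N * t\<rfloor>} k - indicator {s..t} (x k))) / real N < e"
    using eventually_gt_at_top[of "nat \<lceil>3 / e\<rceil>"]
  proof (eventually_elim, intro allI impI)
    fix N and x :: "nat \<Rightarrow> real"
    assume N: "nat \<lceil>3 / e\<rceil> < N" and x: "\<forall>k\<in>{1..N}. x k \<in> cell N k"
    have N0: "real N > 0" and N3: "3 / real N < e"
    proof -
      show "real N > 0" using N by simp
      have "3 / e < real N" using N by linarith
      then show "3 / real N < e" using e \<open>real N > 0\<close> by (simp add: field_simps)
    qed
    \<comment> \<open>The cells \<open>[Ns] + 1\<close> and \<open>[Nt] + 1\<close> contain s and t.
      The cell \<open>[Ns]\<close> reaches s only if Ns is an integer; then the tag s lies in the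
      interval although the index is outside the summation range.\<close>
    define bad where "bad = {nat \<lfloor>real N * s\<rfloor>, nat \<lfloor>real N * s\<rfloor> + 1, nat \<lfloor>real N * t\<rfloor> + 1}"
    have term_le: "cmod (indicator {nat \<lfloor>real N * s\<rfloor> + 1 .. nat \<lfloor>real N * t\<rfloor>} k - indicator {s..t} (x k))
        \<le> indicator bad k" if k: "k \<in> {1..N}" for k
    proof (cases "k \<in> bad")
      case True
      then show ?thesis by (simp add: indicator_def)
    next
      case False
      have xk: "real k - 1 \<le> real N * x k" "real N * x k \<le> real k"
        using x k N0 by (auto simp: cell_def field_simps)
      have s': "x k \<ge> s \<longleftrightarrow> real N * x k \<ge> real N * s" and t': "x k \<le> t \<longleftrightarrow> real N * x k \<le> real N * t"
        using N0 by simp_all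
      have "0 \<le> real N * s" "real N * s \<le> real N * t"
        using st by (simp_all add: mult_left_mono)
      then have "k \<in> {nat \<lfloor>real N * s\<rfloor> + 1 .. nat \<lfloor>real N * t\<rfloor>} \<longleftrightarrow> x k \<in> {s..t}"
        using False xk unfolding bad_def atLeastAtMost_iff s' t' by simp linarith
      then show ?thesis by (simp add: indicator_def)
    qed
    have "(\<Sum>k=1..N. cmod (indicator {nat \<lfloor>real N * s\<rfloor> + 1 .. nat \<lfloor>real N * t\<rfloor>} k - indicator {s..t} (x k)))
        \<le> (\<Sum>k=1..N. indicator bad k)"
      by (rule sum_mono) (rule term_le)
    also have "\<dots> = (\<Sum>k\<in>{1..N} \<inter> bad. 1)"
      by (simp only: sum.inter_restrict[OF finite_atLeastAtMost] indicator_def of_bool_def)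
    also have "\<dots> = real (card ({1..N} \<inter> bad))" by simp
    also have "\<dots> \<le> real (card bad)"
      by (intro of_nat_mono card_mono) (auto simp: bad_def)
    also have "\<dots> \<le> 3"
      unfolding bad_def by (simp add: card_insert_if)
    finally show "(\<Sum>k=1..N. cmod (indicator {nat \<lfloor>real N * s\<rfloor> + 1 .. nat \<lfloor>real N * t\<rfloor>} k - indicator {s..t} (x k)))
        / real N < e"
      using N3 N0 by (smt (verit) divide_right_mono)
  qed
qed (auto simp: indicator_def)

section \<open>Uniform divisions and Riemann integrable functions\<close>

lemma cell_tagged_division:
  assumes N: "N > 0" and x: "\<And>k. k \<in> {1..N} \<Longrightarrow> x k \<in> cell N k"
  shows "(\<lambda>k. (x k, cell N k)) ` {1..N} tagged_division_of {0..1}"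
proof -
  have int: "interior (cell N k) = {(real k - 1) / real N <..< real k / real N}" for k
    by (simp add: cell_def)
  have disj: "interior (cell N j) \<inter> interior (cell N k) = {}" if "j < k" for j k
  proof -
    have "real j \<le> real k - 1" using that by linarith
    then have "real j / real N \<le> (real k - 1) / real N" by (simp add: divide_right_mono)
    then show ?thesis unfolding int by auto
  qed
  show ?thesis
    unfolding tagged_division_of_def tagged_partial_division_of_def
  proof (intro conjI allI impI)
    fix y K assume "(y, K) \<in> (\<lambda>k. (x k, cell N k)) ` {1..N}"
    then obtain k where k: "k \<in> {1..N}" "y = x k" "K = cell N k" by auto
    show "y \<in> K" using k x by simp
    show "K \<subseteq> {0..1}" using k cell_subset by simp
    show "\<exists>a b. K = cbox a b" using k by (auto simp: cell_def)
  next
    fix y1 K1 y2 K2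
    assume "(y1, K1) \<in> (\<lambda>k. (x k, cell N k)) ` {1..N} \<and> (y2, K2) \<in> (\<lambda>k. (x k, cell N k)) ` {1..N}
      \<and> (y1, K1) \<noteq> (y2, K2)"
    then obtain j k where "K1 = cell N j" "K2 = cell N k" "j \<noteq> k" by auto
    then show "interior K1 \<inter> interior K2 = {}"
      using disj[of j k] disj[of k j] by (cases j k rule: linorder_cases) auto
  next
    show "\<Union> {K. \<exists>y. (y, K) \<in> (\<lambda>k. (x k, cell N k)) ` {1..N}} = {0..1}"
    proof (intro subset_antisym subsetI)
      fix y :: real assume y: "y \<in> {0..1}"
      \<comment> \<open>The ceiling of 0 is 0, which is not an index, so the origin is assigned to
        the first cell.\<close>
      define k where "k = (if y = 0 then 1 else nat \<lceil>real N * y\<rceil>)"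
      have "k \<in> {1..N} \<and> y \<in> cell N k"
      proof (cases "y = 0")
        case False
        then have "real N * y > 0" "real N * y \<le> real N" using y N by (auto simp: mult_le_cancel_left1)
        then have "k \<in> {1..N}" "real k - 1 \<le> real N * y" "real N * y \<le> real k"
          using False unfolding k_def by (simp_all, linarith+)
        then show ?thesis using N by (simp add: cell_def field_simps)
      qed (use N in \<open>simp add: k_def cell_def\<close>)
      then show "y \<in> \<Union> {K. \<exists>y. (y, K) \<in> (\<lambda>k. (x k, cell N k)) ` {1..N}}" by blast
    next
      fix y assume "y \<in> \<Union> {K. \<exists>y. (y, K) \<in> (\<lambda>k. (x k, cell N k)) ` {1..N}}"
      then show "y \<in> {0..1}" using cell_subset by blast
    qed
  qed simp
qed

text \<open>A tagged division is a set of pairs. The cells are told apart by their right endpoints,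
  so no pairs merge and a sum over the division is a sum over indices.\<close>

lemma cell_inj:
  assumes "N > 0" shows "inj_on (\<lambda>k. (x k, cell N k)) {1..N}"
proof (rule inj_onI)
  fix j k assume "(x j, cell N j) = (x k, cell N k)"
  then have "cell N j = cell N k" by simp
  moreover have "(real j - 1) / real N \<le> real j / real N" by (simp add: divide_right_mono)
  ultimately have "real j / real N = real k / real N"
    unfolding cell_def by simp
  with assms show "j = k" by simp
qed

text \<open>Integrability is stated with the mesh and not with a gauge, so once 1/N < d every choice
  of tags in the N equal cells gives a sum within e/2 of I. Comparing two choices eliminates
  I.\<close>

lemma riemann_sums_close:
  assumes f: "riemann_integrable_01 f" and e: "e > 0"
  shows "\<forall>\<^sub>F N in sequentially. \<forall>x y. (\<forall>k\<in>{1..N}. x k \<in> cell N k \<and> y k \<in> cell N k) \<longrightarrow>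
    cmod ((\<Sum>k=1..N. f (x k) - f (y k)) / real N) < e"
proof -
  from f obtain I where "\<And>e. e > 0 \<Longrightarrow> \<exists>d>0. \<forall>p. p tagged_division_of {0..1} \<and>
      (\<forall>(x, K)\<in>p. diameter K < d) \<longrightarrow> cmod ((\<Sum>(x, K)\<in>p. measure lborel K *\<^sub>R f x) - I) < e"
    unfolding riemann_integrable_01_def by blast
  from this[of "e / 2"] e obtain d where d: "d > 0" "\<And>p. p tagged_division_of {0..1} \<Longrightarrow>
      (\<forall>(x, K)\<in>p. diameter K < d) \<Longrightarrow> cmod ((\<Sum>(x, K)\<in>p. measure lborel K *\<^sub>R f x) - I) < e / 2"
    by auto
  show ?thesis
    using eventually_gt_at_top[of "nat \<lceil>1 / d\<rceil>"]
  proof (eventually_elim, intro allI impI)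
    fix N and x y :: "nat \<Rightarrow> real"
    assume N: "nat \<lceil>1 / d\<rceil> < N" and xy: "\<forall>k\<in>{1..N}. x k \<in> cell N k \<and> y k \<in> cell N k"
    have N0: "real N > 0" and Nd: "1 / real N < d"
    proof -
      show "real N > 0" using N by simp
      have "1 / d < real N" using N by linarith
      then show "1 / real N < d" using d(1) \<open>real N > 0\<close> by (simp add: field_simps)
    qed
    have len: "real k / real N - (real k - 1) / real N = 1 / real N" for k
      by (simp add: diff_divide_distrib)
    have le: "(real k - 1) / real N \<le> real k / real N" for k by (simp add: divide_right_mono)
    have RS: "cmod ((\<Sum>k=1..N. f (z k)) / real N - I) < e / 2"
      if z: "\<And>k. k \<in> {1..N} \<Longrightarrow> z k \<in> cell N k" for z
    proof -
      let ?p = "(\<lambda>k. (z k, cell N k)) ` {1..N}"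
      have "cmod ((\<Sum>(x, K)\<in>?p. measure lborel K *\<^sub>R f x) - I) < e / 2"
      proof (rule d(2))
        show "?p tagged_division_of {0..1}" using N0 z by (intro cell_tagged_division) auto
        show "\<forall>(x, K)\<in>?p. diameter K < d"
        proof -
          have "diameter (cell N k) = 1 / real N" for k
            using le[of k] len[of k] by (simp add: cell_def)
          with Nd show ?thesis by auto
        qed
      qed
      moreover have "(\<Sum>(x, K)\<in>?p. measure lborel K *\<^sub>R f x) = (\<Sum>k=1..N. f (z k)) / real N"
      proof -
        have "(\<Sum>(x, K)\<in>?p. measure lborel K *\<^sub>R f x) = (\<Sum>k=1..N. measure lborel (cell N k) *\<^sub>R f (z k))"
          using N0 by (subst sum.reindex[OF cell_inj]) (simp_all only: of_nat_0_less_iff o_def prod.case)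
        also have "\<dots> = (\<Sum>k=1..N. f (z k) / real N)"
          using le len by (intro sum.cong refl) (simp add: cell_def scaleR_conv_of_real)
        finally show ?thesis by (simp only: sum_divide_distrib)
      qed
      ultimately show ?thesis by simp
    qed
    have "(\<Sum>k=1..N. f (x k) - f (y k)) / real N =
        ((\<Sum>k=1..N. f (x k)) / real N - I) - ((\<Sum>k=1..N. f (y k)) / real N - I)"
      by (simp add: sum_subtractf diff_divide_distrib)
    also have "cmod \<dots> \<le> cmod ((\<Sum>k=1..N. f (x k)) / real N - I) + cmod ((\<Sum>k=1..N. f (y k)) / real N - I)"
      by (rule norm_triangle_ineq4)
    also have "\<dots> < e / 2 + e / 2"
      using xy by (intro add_strict_mono RS) auto
    finally show "cmod ((\<Sum>k=1..N. f (x k) - f (y k)) / real N) < e" by simp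
  qed
qed

text \<open>Riemann integrability bounds only sums of signed differences, but uniformly over all
  pairs of tags. The freedom in the tags upgrades this to a bound on the sum of moduli, that is, to
  small mean oscillation.\<close>

lemma approximates_riemann:
  assumes f: "f \<in> riemann_bounded_01"
  shows "approximates (\<lambda>N k. f (real k / real N)) f"
  unfolding approximates_def
proof (intro conjI allI impI)
  have ri: "riemann_integrable_01 f" using f by (simp add: riemann_bounded_01_def)
  show "f \<in> borel_measurable LI"
    using riemann_integrable_01_imp_integrable_on[OF ri] by (rule integrable_imp_measurable)
  from f obtain B where B: "\<And>x. x \<in> {0..1} \<Longrightarrow> cmod (f x) \<le> B"
    unfolding riemann_bounded_01_def bounded_iff by blast
  show "\<exists>B. (\<forall>N. \<forall>k\<in>{1..N}. cmod (f (real k / real N)) \<le> B) \<and> (\<forall>x\<in>{0..1}. cmod (f x) \<le> B)"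
    by (intro exI[of _ B]) (auto intro!: B simp: field_simps)
  fix e :: real assume e: "e > 0"
  have "\<forall>\<^sub>F N in sequentially. \<forall>x y. (\<forall>k\<in>{1..N}. x k \<in> cell N k \<and> y k \<in> cell N k) \<longrightarrow>
    cmod ((\<Sum>k=1..N. f (x k) - f (y k)) / real N) < e / 2"
    by (rule riemann_sums_close[OF ri]) (use e in simp)
  then show "\<forall>\<^sub>F N in sequentially. \<forall>x. (\<forall>k\<in>{1..N}. x k \<in> cell N k) \<longrightarrow>
        (\<Sum>k=1..N. cmod (f (real k / real N) - f (x k))) / real N < e"
  proof (eventually_elim, intro allI impI)
    fix N and x :: "nat \<Rightarrow> real"
    assume *: "\<forall>x y. (\<forall>k\<in>{1..N}. x k \<in> cell N k \<and> y k \<in> cell N k) \<longrightarrow>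
      cmod ((\<Sum>k=1..N. f (x k) - f (y k)) / real N) < e / 2" and x: "\<forall>k\<in>{1..N}. x k \<in> cell N k"
    define z where "z k = real k / real N" for k
    have z: "z k \<in> cell N k" for k by (simp add: z_def cell_def divide_right_mono)
    \<comment> \<open>Interchanging the two tags of a cell makes all terms of the real (or imaginary) part nonnegative.\<close>
    have part: "(\<Sum>k=1..N. \<bar>r (f (z k) - f (x k))\<bar>) / real N < e / 2"
      if r: "\<And>v. \<bar>r v\<bar> \<le> cmod v" "\<And>v. r (- v) = - r v" "\<And>v. r (v / of_nat N) = r v / real N"
        "\<And>g (A :: nat set). r (sum g A) = (\<Sum>k\<in>A. r (g k))" for r :: "complex \<Rightarrow> real"
    proof -
      define b where "b k \<longleftrightarrow> r (f (z k) - f (x k)) \<ge> 0" for k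
      define u where "u k = (if b k then z k else x k)" for k
      define v where "v k = (if b k then x k else z k)" for k
      have "r (f (u k) - f (v k)) = \<bar>r (f (z k) - f (x k))\<bar>" for k
        using r(2)[of "f (z k) - f (x k)"] by (auto simp: u_def v_def b_def)
      then have "(\<Sum>k=1..N. \<bar>r (f (z k) - f (x k))\<bar>) / real N = r ((\<Sum>k=1..N. f (u k) - f (v k)) / real N)"
        unfolding of_real_of_nat_eq r(3) r(4) by simp
      also have "\<dots> \<le> cmod ((\<Sum>k=1..N. f (u k) - f (v k)) / real N)"
        using r(1) by (rule order_trans[OF abs_ge_self])
      also have "\<dots> < e / 2"
        using * x z by (auto simp: u_def v_def)
      finally show ?thesis .
    qed
    have "(\<Sum>k=1..N. cmod (f (z k) - f (x k))) / real N \<le>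
        (\<Sum>k=1..N. \<bar>Re (f (z k) - f (x k))\<bar> + \<bar>Im (f (z k) - f (x k))\<bar>) / real N"
      by (intro divide_right_mono sum_mono cmod_le) simp
    also have "\<dots> = (\<Sum>k=1..N. \<bar>Re (f (z k) - f (x k))\<bar>) / real N + (\<Sum>k=1..N. \<bar>Im (f (z k) - f (x k))\<bar>) / real N"
      by (simp add: sum.distrib add_divide_distrib)
    also have "\<dots> < e / 2 + e / 2"
      by (intro add_strict_mono part) (auto simp: abs_Re_le_cmod abs_Im_le_cmod)
    finally show "(\<Sum>k=1..N. cmod (f (real k / real N) - f (x k))) / real N < e"
      by (simp add: z_def)
  qed
qed

section \<open>Riemann sums\<close>

text \<open>Boundedness and measurability suffice, the measure being finite. The gauge integral
  serves the estimates over cells; the Lebesgue integral is the one in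
  \<open>cannihilate\<close>.\<close>

lemma approximates_integrable:
  assumes "approximates HN H"
  shows "integrable LI H" "integrable LI (\<lambda>u. indicator {u. u < x} u *\<^sub>R H u)" "H integrable_on {0..1}"
proof -
  note H = approximates_measurable[OF assms]
  obtain B where B: "B > 0" "\<forall>u\<in>{0..1}. cmod (H u) \<le> B"
    using approximates_bound[OF assms] by blast
  show "integrable LI H"
    by (rule LI.integrable_const_bound[where B = B]) (use B H in auto)
  moreover have "(\<lambda>u. indicator {u. u < x} u *\<^sub>R H u) \<in> borel_measurable LI"
    by (intro borel_measurable_scaleR H measurable_compose[OF borel_measurable_LI]) simp
  ultimately show "integrable LI (\<lambda>u. indicator {u. u < x} u *\<^sub>R H u)"
    by (rule Bochner_Integration.integrable_bound) (auto simp: indicator_def)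
  show "H integrable_on {0..1}"
    by (rule integrable_on_lebesgue_on) (use \<open>integrable LI H\<close> in simp_all)
qed

text \<open>Passes from the integral in \<open>cannihilate\<close> to the gauge integral, for which
  additivity over intervals and continuity in the upper limit are at hand. The integrands differ at
  most at u = x.\<close>

lemma LI_integral_lessThan:
  assumes H: "approximates HN H" and x: "x \<in> {0..1}"
  shows "(LINT u:{u. u < x}|LI. H u) = integral {0..x} H"
proof -
  have "(LINT u:{u. u < x}|LI. H u) = integral {0..1} (\<lambda>u. indicator {u. u < x} u *\<^sub>R H u)"
    unfolding set_lebesgue_integral_def
    by (rule lebesgue_integral_eq_integral[OF approximates_integrable(2)[OF H]]) simp
  also have "\<dots> = integral {0..1} (\<lambda>u. if u \<in> {0..x} then H u else 0)"
    by (rule integral_spike[of "{x}"]) (auto simp: indicator_def)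
  also have "\<dots> = integral {0..x} H"
    using x by (simp only: integral_restrict_Int Int_atLeastAtMost) (simp add: min_def max_def)
  finally show ?thesis .
qed

lemma integral_Icc_bound:
  fixes H :: "real \<Rightarrow> complex"
  assumes H: "H integrable_on {0..1}" and B: "0 \<le> B" "\<And>x. x \<in> {a..b} \<Longrightarrow> cmod (H x) \<le> B"
    and ab: "0 \<le> a" "a \<le> b" "b \<le> 1"
  shows "cmod (integral {a..b} H) \<le> B * (b - a)"
proof -
  have "H integrable_on {a..b}"
    by (rule integrable_on_subinterval[OF H]) (use ab in auto)
  then have "(H has_integral integral {a..b} H) (cbox a b)"
    by (simp add: has_integral_integral)
  from has_integral_bound[OF B(1) this] B(2) show ?thesis using ab by simp
qed

text \<open>Converts an error against an integral into an error at a tag, which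
  \<open>approximates\<close> controls. The quantity on the left is the modulus C of the integral of
  v - H over a cell of length 1/N. If the modulus of v - H stayed below C N / 2 throughout the cell,
  then C would be at most C / 2, although C > 0. The factor 2 makes the non-strict integral bound
  sufficient for this contradiction.\<close>

lemma cell_integral_error:
  fixes H :: "real \<Rightarrow> complex" and v :: complex
  assumes H: "H integrable_on {0..1}" and k: "k \<in> {1..N}"
  shows "\<exists>y\<in>cell N k. cmod (v / real N - integral (cell N k) H) \<le> 2 * cmod (v - H y) / real N"
proof (rule ccontr)
  assume "\<not> ?thesis"
  then have less: "2 * cmod (v - H y) / real N < cmod (v / real N - integral (cell N k) H)"
    if "y \<in> cell N k" for y using that by force
  have N: "real N > 0" and k01: "0 \<le> (real k - 1) / real N" "(real k - 1) / real N \<le> real k / real N" "real k / real N \<le> 1"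
    using k by (auto simp: field_simps)
  define C where "C = cmod (v / real N - integral (cell N k) H)"
  have Hk: "H integrable_on cell N k"
    unfolding cell_def by (rule integrable_on_subinterval[OF H]) (use k01 in auto)
  have cv: "((\<lambda>_. v) has_integral v / real N) (cell N k)"
    using has_integral_const_real[of v "(real k - 1) / real N" "real k / real N"] k01 N
    by (simp add: cell_def diff_divide_distrib scaleR_conv_of_real)
  have "((\<lambda>y. v - H y) has_integral (v / real N - integral (cell N k) H)) (cell N k)"
    by (intro has_integral_diff cv integrable_integral Hk)
  then have hi: "((\<lambda>y. v - H y) has_integral (v / real N - integral (cell N k) H))
      (cbox ((real k - 1) / real N) (real k / real N))" by (simp add: cell_def)
  have C0: "0 \<le> C * real N / 2" by (simp add: C_def)
  have "cmod (v / real N - integral (cell N k) H) \<le>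
      C * real N / 2 * measure lborel (cbox ((real k - 1) / real N) (real k / real N))"
  proof (rule has_integral_bound[OF C0 hi])
    fix y assume "y \<in> cbox ((real k - 1) / real N) (real k / real N)"
    then have "y \<in> cell N k" by (simp add: cell_def)
    from less[OF this] N show "cmod (v - H y) \<le> C * real N / 2"
      unfolding C_def by (simp add: field_simps)
  qed
  also have "\<dots> = C / 2"
    using k01 N by (simp add: diff_divide_distrib)
  finally have "C \<le> 0" unfolding C_def[symmetric] by simp
  moreover have "0 < C"
  proof -
    have "real k / real N \<in> cell N k" using k01 by (simp add: cell_def)
    from less[OF this] show ?thesis unfolding C_def
      by (rule le_less_trans[rotated]) simp
  qed
  ultimately show False by simp
qed

lemma integral_cells:
  fixes H :: "real \<Rightarrow> complex"
  assumes H: "H integrable_on {0..1}" and k: "k \<le> N"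
  shows "integral {0..real k / real N} H = (\<Sum>j=1..k. integral (cell N j) H)"
  using k
proof (induction k)
  case (Suc k)
  have "integral {0..real k / real N} H + integral {real k / real N..real (Suc k) / real N} H =
      integral {0..real (Suc k) / real N} H"
  proof (rule Henstock_Kurzweil_Integration.integral_combine)
    show "H integrable_on {0..real (Suc k) / real N}"
      by (rule integrable_on_subinterval[OF H]) (use Suc.prems in \<open>auto simp: field_simps\<close>)
  qed (auto simp: divide_right_mono)
  with Suc show ?case by (simp add: cell_def)
qed simp

text \<open>The tags supplied by \<open>cell_integral_error\<close> depend on N and HN, which is
  harmless since \<open>approximates\<close> admits all tags. The cell errors are added in modulus,
  so the sum over all N cells bounds every partial sum at once.\<close>

lemma approximates_partial_integrals:
  assumes H: "approximates HN H" and e: "e > 0"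
  shows "\<forall>\<^sub>F N in sequentially. \<forall>k\<le>N.
    cmod ((\<Sum>j=1..k. HN N j) / real N - integral {0..real k / real N} H) < e"
proof -
  note int = approximates_integrable(3)[OF H]
  have "\<forall>\<^sub>F N in sequentially. \<forall>x. (\<forall>k\<in>{1..N}. x k \<in> cell N k) \<longrightarrow>
        (\<Sum>k=1..N. cmod (HN N k - H (x k))) / real N < e / 2"
    by (rule approximatesD[OF H]) (use e in simp)
  then show ?thesis
  proof (eventually_elim, intro allI impI)
    fix N k
    assume *: "\<forall>x. (\<forall>k\<in>{1..N}. x k \<in> cell N k) \<longrightarrow>
        (\<Sum>k=1..N. cmod (HN N k - H (x k))) / real N < e / 2" and k: "k \<le> N"
    have "\<forall>j\<in>{1..N}. \<exists>y. y \<in> cell N j \<and>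
        cmod (HN N j / real N - integral (cell N j) H) \<le> 2 * cmod (HN N j - H y) / real N"
      using cell_integral_error[OF int] by blast
    then obtain y where y: "\<And>j. j \<in> {1..N} \<Longrightarrow> y j \<in> cell N j"
      "\<And>j. j \<in> {1..N} \<Longrightarrow> cmod (HN N j / real N - integral (cell N j) H) \<le> 2 * cmod (HN N j - H (y j)) / real N"
      by metis
    have "(\<Sum>j=1..k. HN N j) / real N - integral {0..real k / real N} H =
        (\<Sum>j=1..k. HN N j / real N - integral (cell N j) H)"
      unfolding integral_cells[OF int k] by (simp add: sum_subtractf sum_divide_distrib)
    also have "cmod \<dots> \<le> (\<Sum>j=1..k. cmod (HN N j / real N - integral (cell N j) H))"
      by (rule norm_sum)
    also have "\<dots> \<le> (\<Sum>j=1..N. cmod (HN N j / real N - integral (cell N j) H))"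
      by (rule sum_mono2) (use k in auto)
    also have "\<dots> \<le> (\<Sum>j=1..N. 2 * cmod (HN N j - H (y j)) / real N)"
      by (rule sum_mono) (rule y(2))
    also have "\<dots> = 2 * ((\<Sum>j=1..N. cmod (HN N j - H (y j))) / real N)"
      by (simp add: sum_distrib_left sum_divide_distrib)
    also have "\<dots> < 2 * (e / 2)"
      by (rule mult_strict_left_mono, rule *[rule_format], rule y(1)) simp_all
    finally show "cmod ((\<Sum>j=1..k. HN N j) / real N - integral {0..real k / real N} H) < e" by simp
  qed
qed

lemma approximates_total_integral:
  assumes H: "approximates HN H"
  shows "(\<lambda>N. (\<Sum>k=1..N. HN N k) / real N) \<longlonglongrightarrow> (\<integral>u. H u \<partial>LI)"
proof (rule tendstoI)
  fix e :: real assume "e > 0"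
  have I: "(\<integral>u. H u \<partial>LI) = integral {0..1} H"
    by (rule lebesgue_integral_eq_integral[OF approximates_integrable(1)[OF H]]) simp
  show "\<forall>\<^sub>F N in sequentially. dist ((\<Sum>k=1..N. HN N k) / real N) (\<integral>u. H u \<partial>LI) < e"
    \<comment> \<open>N > 0 ensures N / N = 1, so that taking k = N gives the integral over the
      whole interval.\<close>
    using approximates_partial_integrals[OF H \<open>e > 0\<close>] eventually_gt_at_top[of 0]
  proof eventually_elim
    case (elim N)
    from elim(1)[rule_format, of N] elim(2) show ?case by (simp add: dist_norm I)
  qed
qed

text \<open>The error is even uniform in k: the partial sum is close to the integral up to the left
  endpoint of the cell, and going on to any tag of the cell changes that integral by at most
  B/N.\<close>

lemma approximates_running_integral:
  assumes H: "approximates HN H"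
  shows "approximates (\<lambda>N k. (\<Sum>j=1..<k. HN N j) / real N) (\<lambda>x. LINT u:{u. u < x}|LI. H u)"
proof -
  note int = approximates_integrable(3)[OF H]
  obtain B where B: "B > 0" "\<forall>N. \<forall>k\<in>{1..N}. cmod (HN N k) \<le> B" "\<forall>u\<in>{0..1}. cmod (H u) \<le> B"
    using approximates_bound[OF H] by blast
  show ?thesis
    unfolding approximates_def
  proof (intro conjI exI[of _ B] allI impI ballI)
    \<comment> \<open>On the unit interval the function is an indefinite integral, hence continuous;
      its measurability comes from this.\<close>
    have "continuous_on {0..1} (\<lambda>x. integral {0..x} H)"
      by (rule indefinite_integral_continuous_1[OF int])
    then have "(\<lambda>x. integral {0..x} H) \<in> borel_measurable LI"
      by (rule continuous_imp_measurable_on_sets_lebesgue) simp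
    then show "(\<lambda>x. LINT u:{u. u < x}|LI. H u) \<in> borel_measurable LI"
      by (rule measurable_cong[THEN iffD2, rotated]) (simp add: LI_integral_lessThan[OF H])
    show "cmod ((\<Sum>j=1..<k. HN N j) / real N) \<le> B" if k: "k \<in> {1..N}" for N k
    proof -
      have "cmod (\<Sum>j=1..<k. HN N j) \<le> (\<Sum>j=1..<k. B)"
        using B k by (intro sum_norm_le) auto
      also have "\<dots> \<le> real N * B" using B k by simp
      finally show ?thesis using k by (simp add: norm_divide field_simps)
    qed
    show "cmod (LINT u:{u. u < x}|LI. H u) \<le> B" if x: "x \<in> {0..1}" for x
    proof -
      have "cmod (integral {0..x} H) \<le> B * (x - 0)"
        using B x by (intro integral_Icc_bound int) auto
      also have "\<dots> \<le> B" using B x by (simp add: mult_left_le)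
      finally show ?thesis unfolding LI_integral_lessThan[OF H x] .
    qed
    fix e :: real assume e: "e > 0"
    \<comment> \<open>Two errors of e/4 give at most e/2 for each index, hence for the mean, which
      leaves room for the strict inequality.\<close>
    have "\<forall>\<^sub>F N in sequentially. \<forall>k\<le>N.
      cmod ((\<Sum>j=1..k. HN N j) / real N - integral {0..real k / real N} H) < e / 4"
      by (rule approximates_partial_integrals[OF H]) (use e in simp)
    moreover have "\<forall>\<^sub>F N in sequentially. B / real N < e / 4"
      using e by (intro order_tendstoD(2)[OF lim_const_over_n]) simp
    ultimately show "\<forall>\<^sub>F N in sequentially. \<forall>x. (\<forall>k\<in>{1..N}. x k \<in> cell N k) \<longrightarrow>
      (\<Sum>k=1..N. cmod ((\<Sum>j=1..<k. HN N j) / real N - (LINT u:{u. u < x k}|LI. H u))) / real N < e"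
    proof (eventually_elim, intro allI impI)
      fix N and x :: "nat \<Rightarrow> real"
      assume *: "\<forall>k\<le>N. cmod ((\<Sum>j=1..k. HN N j) / real N - integral {0..real k / real N} H) < e / 4"
        and BN: "B / real N < e / 4" and x: "\<forall>k\<in>{1..N}. x k \<in> cell N k"
      have "cmod ((\<Sum>j=1..<k. HN N j) / real N - (LINT u:{u. u < x k}|LI. H u)) \<le> e / 2"
        if k: "k \<in> {1..N}" for k
      proof -
        \<comment> \<open>The strict limit j < k stops at the node of index k - 1, the left endpoint
          of cell k.\<close>
        define a where "a = real (k - 1) / real N"
        have x01: "x k \<in> {0..1}" using x k cell_subset by blast
        have "x k \<in> cell N k" using x k by blast
        then have a: "0 \<le> a" "a \<le> x k" "x k - a \<le> 1 / real N"
          using k by (auto simp: a_def cell_def diff_divide_distrib divide_right_mono)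
        have "integral {0..a} H + integral {a..x k} H = integral {0..x k} H"
          by (rule Henstock_Kurzweil_Integration.integral_combine)
            (use a x01 in \<open>auto intro: integrable_on_subinterval[OF int]\<close>)
        then have "(\<Sum>j=1..<k. HN N j) / real N - (LINT u:{u. u < x k}|LI. H u) =
            ((\<Sum>j=1..k - 1. HN N j) / real N - integral {0..a} H) - integral {a..x k} H"
          unfolding LI_integral_lessThan[OF H x01]
          using k by (simp add: atLeastLessThanSuc_atLeastAtMost[symmetric] algebra_simps)
        also have "cmod \<dots> \<le> cmod ((\<Sum>j=1..k - 1. HN N j) / real N - integral {0..a} H) + cmod (integral {a..x k} H)"
          by (rule norm_triangle_ineq4)
        also have "\<dots> \<le> e / 4 + B * (x k - a)"
        proof (intro add_mono)
          show "cmod ((\<Sum>j=1..k - 1. HN N j) / real N - integral {0..a} H) \<le> e / 4"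
            unfolding a_def by (rule less_imp_le, rule *[rule_format]) (use k in auto)
          show "cmod (integral {a..x k} H) \<le> B * (x k - a)"
            using B a x01 by (intro integral_Icc_bound int) auto
        qed
        also have "B * (x k - a) \<le> B * (1 / real N)"
          using B a by (intro mult_left_mono) auto
        also have "B * (1 / real N) \<le> e / 4" using BN by simp
        finally show ?thesis by simp
      qed
      then have "(\<Sum>k=1..N. cmod ((\<Sum>j=1..<k. HN N j) / real N - (LINT u:{u. u < x k}|LI. H u))) \<le>
          (\<Sum>k=1..N. e / 2)"
        by (rule sum_mono)
      then have "(\<Sum>k=1..N. cmod ((\<Sum>j=1..<k. HN N j) / real N - (LINT u:{u. u < x k}|LI. H u))) / real N
          \<le> e / 2"
        using e by (cases "N = 0") (simp_all add: field_simps)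
      also have "\<dots> < e" using e by simp
      finally show "(\<Sum>k=1..N. cmod ((\<Sum>j=1..<k. HN N j) / real N - (LINT u:{u. u < x k}|LI. H u))) / real N < e" .
    qed
  qed
qed

section \<open>Elementary tensors\<close>

text \<open>Lists of unequal length give 0, so one formula describes a homogeneous vector in all
  degrees. The order constraint is left out: it enters through \<open>incr_seqs\<close> in the
  discrete space and through the simplex in the continuous one.\<close>

fun tensor :: "('a \<Rightarrow> complex) list \<Rightarrow> 'a list \<Rightarrow> complex" where
  "tensor [] [] = 1"
| "tensor (F # Fs) (x # xs) = F x * tensor Fs xs"
| "tensor _ _ = 0"

lemma tensor_Nil: "tensor [] xs = (if xs = [] then 1 else 0)"
  by (cases xs) auto

lemma tensor_Cons: "tensor (F # Fs) xs = (case xs of [] \<Rightarrow> 0 | y # ys \<Rightarrow> F y * tensor Fs ys)"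
  by (cases xs) auto

text \<open>The coefficient of the k-th creation operator in \<open>dS\<close>, without 1 / sqrt N.
  Extension by 0 outside the summation range absorbs the interval into the function, as the
  indicator does in the limit.\<close>

definition dcoeff :: "real \<Rightarrow> real \<Rightarrow> (real \<Rightarrow> complex) \<Rightarrow> nat \<Rightarrow> nat \<Rightarrow> complex" where
  "dcoeff s t f N k = f (real k / real N) * indicator {nat \<lfloor>real N * s\<rfloor> + 1 .. nat \<lfloor>real N * t\<rfloor>} k"

lemma approximates_dcoeff:
  assumes "f \<in> riemann_bounded_01" "0 \<le> s" "s \<le> t"
  shows "approximates (dcoeff s t f) (\<lambda>x. f x * indicator {s..t} x)"
  unfolding dcoeff_def[abs_def]
  by (rule approximates_mult[OF approximates_riemann[OF assms(1)] approximates_indicator[OF assms(2,3)]])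

lemma dcoeff_eq_0:
  assumes "t \<le> 1" "k \<notin> {1..N}" shows "dcoeff s t f N k = 0"
proof -
  have "real N * t \<le> real N" using assms by (simp add: mult_left_le)
  then have "k \<notin> {nat \<lfloor>real N * s\<rfloor> + 1 .. nat \<lfloor>real N * t\<rfloor>}" using assms(2) by simp linarith
  then show ?thesis by (simp add: dcoeff_def)
qed

text \<open>At a nonempty sequence only the summand whose index is the first entry survives, so the
  sum collapses to one term.\<close>

lemma dS_create:
  "dS N s t 1 f x \<alpha> = (case \<alpha> of [] \<Rightarrow> 0 | j # \<beta> \<Rightarrow>
     if \<alpha> \<in> incr_seqs then dcoeff s t f N j / sqrt (real N) * x \<beta> else 0)"
proof (cases \<alpha>)
  case (Cons j \<beta>)
  let ?R = "{nat \<lfloor>real N * s\<rfloor> + 1 .. nat \<lfloor>real N * t\<rfloor>}"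
  have "(\<Sum>k\<in>?R. f (real k / real N) * dcreate k x \<alpha>) =
      (\<Sum>k\<in>?R. if k = j then (if \<alpha> \<in> incr_seqs then f (real j / real N) * x \<beta> else 0) else 0)"
    by (intro sum.cong refl) (auto simp: dcreate_def Cons)
  also have "\<dots> = (if \<alpha> \<in> incr_seqs then dcoeff s t f N j * x \<beta> else 0)"
    by (subst sum.delta) (auto simp: dcoeff_def indicator_def)
  finally show ?thesis by (simp add: dS_def Cons)
qed (simp add: dS_def dcreate_def)

lemma dS_annihilate:
  assumes "t \<le> 1" "\<epsilon> \<noteq> 1"
  shows "dS N s t \<epsilon> f x \<beta> = (\<Sum>k\<in>{k\<in>{1..N}. k # \<beta> \<in> incr_seqs}.
     cnj (dcoeff s t f N k) / sqrt (real N) * x (k # \<beta>))"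
proof -
  let ?R = "{nat \<lfloor>real N * s\<rfloor> + 1 .. nat \<lfloor>real N * t\<rfloor>}"
  have "real N * t \<le> real N" using assms by (simp add: mult_left_le)
  then have sub: "?R \<subseteq> {1..N}" by (intro atLeastatMost_subset_iff[THEN iffD2]) linarith
  have "dS N s t \<epsilon> f x \<beta> = 1 / complex_of_real (sqrt (real N)) *
      (\<Sum>k\<in>?R. cnj (f (real k / real N)) * dannihilate k x \<beta>)"
    using assms by (simp add: dS_def)
  also have "\<dots> = (\<Sum>k\<in>?R. cnj (f (real k / real N)) / sqrt (real N) * (if k # \<beta> \<in> incr_seqs then x (k # \<beta>) else 0))"
    by (simp add: sum_distrib_left dannihilate_def mult.assoc)
  also have "\<dots> = (\<Sum>k\<in>{k\<in>{1..N}. k # \<beta> \<in> incr_seqs}.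
     cnj (dcoeff s t f N k) / sqrt (real N) * x (k # \<beta>))"
    using sub by (intro sum.mono_neutral_cong) (auto simp: dcoeff_def indicator_def)
  finally show ?thesis .
qed

text \<open>The degree k coordinates of the discrete vectors carry a factor \<open>N powr (-k/2)\<close>.\<close>

definition tensors_converge ::
  "((nat \<Rightarrow> nat \<Rightarrow> complex) \<times> (real \<Rightarrow> complex)) list \<Rightarrow>
    (nat \<Rightarrow> nat list \<Rightarrow> complex) \<Rightarrow> cvec \<Rightarrow> bool" where
  "tensors_converge L X Y \<longleftrightarrow> (\<forall>(FN, F)\<in>set L. approximates FN F) \<and>
     (\<exists>cN c. cN \<longlonglongrightarrow> c \<and>
       (\<forall>N. \<forall>\<alpha>\<in>incr_seqs. X N \<alpha> = cN N * tensor (map (\<lambda>p k. fst p N k / complex_of_real (sqrt (real N))) L) \<alpha>) \<and>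
       (\<forall>n t. Y n t = c * tensor (map snd L) (map t [0..<n])))"

section \<open>The vacuum and the effect of a single operator on elementary tensors\<close>

lemma map_upt_0_Suc: "map t [0..<Suc n] = t 0 # map (\<lambda>i. t (Suc i)) [0..<n]"
  by (simp add: upt_conv_Cons map_Suc_upt[symmetric] del: upt_Suc)

lemma map_case_nat_upt: "map (case_nat u t) [0..<Suc n] = u # map t [0..<n]"
  by (simp add: map_upt_0_Suc del: upt_Suc)

lemma tensors_converge_vacuum: "tensors_converge [] (\<lambda>_. dvacuum) cvacuum"
  unfolding tensors_converge_def
  by (auto simp: tensor_Nil dvacuum_def dbasis_def cvacuum_def intro!: exI[of _ "\<lambda>_. 1"] exI[of _ 1])

text \<open>The factor 1 / sqrt N of the operator is exactly the normalisation of the new first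
  factor, so the scalars are unchanged.\<close>

lemma tensors_converge_create:
  assumes XY: "tensors_converge L X Y" and g: "approximates (dcoeff s t f) g"
  shows "tensors_converge ((dcoeff s t f, g) # L) (\<lambda>N. dS N s t 1 f (X N)) (ccreate g Y)"
proof -
  obtain cN c where c: "cN \<longlonglongrightarrow> c"
    and X: "\<And>N \<alpha>. \<alpha> \<in> incr_seqs \<Longrightarrow> X N \<alpha> = cN N * tensor (map (\<lambda>p k. fst p N k / complex_of_real (sqrt (real N))) L) \<alpha>"
    and Y: "\<And>n t. Y n t = c * tensor (map snd L) (map t [0..<n])"
    using XY unfolding tensors_converge_def by blast
  show ?thesis
    unfolding tensors_converge_def
  proof (intro conjI exI[of _ cN] exI[of _ c] allI ballI c)
    show "case p of (FN, F) \<Rightarrow> approximates FN F" if "p \<in> set ((dcoeff s t f, g) # L)" for p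
      using that XY g by (auto simp: tensors_converge_def)
    show "dS N s t 1 f (X N) \<alpha> = cN N *
        tensor (map (\<lambda>p k. fst p N k / complex_of_real (sqrt (real N))) ((dcoeff s t f, g) # L)) \<alpha>"
      if "\<alpha> \<in> incr_seqs" for N \<alpha>
      using that by (cases \<alpha>) (auto simp: dS_create X incr_seqs_Cons)
    show "ccreate g Y n u = c * tensor (map snd ((dcoeff s t f, g) # L)) (map u [0..<n])" for n u
      by (cases n) (simp_all add: ccreate_def Y map_upt_0_Suc del: upt_Suc)
  qed
qed

text \<open>Annihilation kills multiples of the vacuum. The zero vector is represented by a tensor
  with one zero factor, and not by the empty tensor with scalar 0, so that the length of the list
  changes parity here too.\<close>

lemma tensors_converge_annihilate_Nil:
  assumes XY: "tensors_converge [] X Y" and t: "t \<le> 1" and \<epsilon>: "\<epsilon> \<noteq> 1"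
  shows "tensors_converge [(\<lambda>_ _. 0, \<lambda>_. 0)] (\<lambda>N. dS N s t \<epsilon> f (X N)) (cannihilate g Y)"
proof -
  obtain cN c where "\<And>N \<alpha>. \<alpha> \<in> incr_seqs \<Longrightarrow> X N \<alpha> = cN N * tensor [] \<alpha>"
    and "\<And>n t. Y n t = c * tensor [] (map t [0..<n])"
    using XY unfolding tensors_converge_def by auto
  then have "dS N s t \<epsilon> f (X N) \<alpha> = 0" "cannihilate g Y n u = 0" for N \<alpha> n u
    using t \<epsilon> by (auto simp: dS_annihilate tensor_Nil cannihilate_def intro!: sum.neutral)
  then show ?thesis
    unfolding tensors_converge_def
    by (auto simp: approximates_zero tensor_Cons split: list.splits intro!: exI[of _ "\<lambda>_. 0"] exI[of _ 0])
qed

text \<open>The factors 1 / sqrt N of the operator and of the contracted factor combine to the mesh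
  1/N. No coordinate remains to restrict the sum, so a full Riemann sum joins the scalar and
  converges to the full integral.\<close>

lemma tensors_converge_annihilate_singleton:
  assumes XY: "tensors_converge [(FN, F)] X Y" and g: "approximates (dcoeff s t f) g"
    and t: "t \<le> 1" and \<epsilon>: "\<epsilon> \<noteq> 1"
  shows "tensors_converge [] (\<lambda>N. dS N s t \<epsilon> f (X N)) (cannihilate g Y)"
proof -
  obtain cN c where c: "cN \<longlonglongrightarrow> c"
    and X: "\<And>N \<alpha>. \<alpha> \<in> incr_seqs \<Longrightarrow> X N \<alpha> = cN N * tensor [\<lambda>k. FN N k / complex_of_real (sqrt (real N))] \<alpha>"
    and Y: "\<And>n t. Y n t = c * tensor [F] (map t [0..<n])"
    and F: "approximates FN F"
    using XY unfolding tensors_converge_def by auto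
  define HN where "HN = (\<lambda>N k. cnj (dcoeff s t f N k) * FN N k)"
  have H: "approximates HN (\<lambda>x. cnj (g x) * F x)"
    unfolding HN_def by (intro approximates_mult approximates_cnj g F)
  show ?thesis
    unfolding tensors_converge_def
  proof (intro conjI exI[of _ "\<lambda>N. cN N * ((\<Sum>k=1..N. HN N k) / real N)"]
      exI[of _ "c * (\<integral>u. cnj (g u) * F u \<partial>LI)"] allI ballI)
    show "(\<lambda>N. cN N * ((\<Sum>k=1..N. HN N k) / real N)) \<longlonglongrightarrow> c * (\<integral>u. cnj (g u) * F u \<partial>LI)"
      by (intro tendsto_mult c approximates_total_integral H)
    show "dS N s t \<epsilon> f (X N) \<alpha> = cN N * ((\<Sum>k=1..N. HN N k) / real N) *
        tensor (map (\<lambda>p k. fst p N k / complex_of_real (sqrt (real N))) []) \<alpha>" if "\<alpha> \<in> incr_seqs" for N \<alpha>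
    proof (cases \<alpha>)
      case Nil
      have "{k\<in>{1..N}. [k] \<in> incr_seqs} = {1..N}" by (auto simp: incr_seqs_Cons)
      then have "dS N s t \<epsilon> f (X N) \<alpha> =
          (\<Sum>k=1..N. cnj (dcoeff s t f N k) / sqrt (real N) * (cN N * (FN N k / sqrt (real N))))"
        using t \<epsilon> Nil by (simp add: dS_annihilate X incr_seqs_Cons)
      also have "\<dots> = (\<Sum>k=1..N. cN N * (HN N k / real N))"
        by (intro sum.cong refl) (simp add: HN_def field_simps flip: of_real_mult)
      finally show ?thesis by (simp add: Nil sum_distrib_left sum_divide_distrib)
    qed (use that t \<epsilon> in \<open>auto simp: dS_annihilate X intro!: sum.neutral\<close>)
    show "cannihilate g Y n u = c * (\<integral>u. cnj (g u) * F u \<partial>LI) * tensor (map snd []) (map u [0..<n])" for n u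
    proof (cases n)
      case 0
      have "Y (Suc 0) (case_nat v u) = c * F v" for v
        unfolding Y map_case_nat_upt by simp
      then have "cannihilate g Y n u = (LINT v|LI. c * (cnj (g v) * F v))"
        by (simp add: cannihilate_def 0 set_lebesgue_integral_def mult.left_commute)
      then show ?thesis by (simp add: 0)
    next
      case (Suc k)
      have "Y (Suc n) (case_nat v u) = 0" for v
        unfolding Y map_case_nat_upt by (simp add: Suc tensor_Nil)
      then show ?thesis by (simp add: cannihilate_def Suc tensor_Nil)
    qed
  qed simp
qed

text \<open>Monotonicity restricts the contracted index to lie below the first remaining one, so the
  sum becomes a running sum in that index. It is absorbed into the next factor, and the scalars stay
  as they are.\<close>

lemma tensors_converge_annihilate_Cons:
  assumes XY: "tensors_converge ((FN, F) # (GN, G) # L) X Y" and g: "approximates (dcoeff s t f) g"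
    and t: "t \<le> 1" and \<epsilon>: "\<epsilon> \<noteq> 1"
  shows "tensors_converge
     ((\<lambda>N k. (\<Sum>j=1..<k. cnj (dcoeff s t f N j) * FN N j) / real N * GN N k,
       \<lambda>x. (LINT u:{u. u < x}|LI. cnj (g u) * F u) * G x) # L)
     (\<lambda>N. dS N s t \<epsilon> f (X N)) (cannihilate g Y)"
proof -
  obtain cN c where c: "cN \<longlonglongrightarrow> c"
    and X: "\<And>N \<alpha>. \<alpha> \<in> incr_seqs \<Longrightarrow> X N \<alpha> = cN N * tensor (map (\<lambda>p k. fst p N k / complex_of_real (sqrt (real N))) ((FN, F) # (GN, G) # L)) \<alpha>"
    and Y: "\<And>n t. Y n t = c * tensor (map snd ((FN, F) # (GN, G) # L)) (map t [0..<n])"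
    and F: "approximates FN F" and G: "approximates GN G" and L: "\<forall>(FN, F)\<in>set L. approximates FN F"
    using XY unfolding tensors_converge_def by auto
  define HN where "HN = (\<lambda>N k. cnj (dcoeff s t f N k) * FN N k)"
  define I where "I x = (LINT u:{u. u < x}|LI. cnj (g u) * F u)" for x
  have H: "approximates HN (\<lambda>x. cnj (g x) * F x)"
    unfolding HN_def by (intro approximates_mult approximates_cnj g F)
  have I: "approximates (\<lambda>N k. (\<Sum>j=1..<k. HN N j) / real N) I"
    unfolding I_def[abs_def] by (rule approximates_running_integral[OF H])
  let ?L = "(\<lambda>N k. (\<Sum>j=1..<k. HN N j) / real N * GN N k, \<lambda>x. I x * G x) # L"
  have "tensors_converge ?L (\<lambda>N. dS N s t \<epsilon> f (X N)) (cannihilate g Y)"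
    unfolding tensors_converge_def
  proof (intro conjI exI[of _ cN] exI[of _ c] allI ballI c)
    show "case p of (FN, F) \<Rightarrow> approximates FN F" if "p \<in> set ?L" for p
      using that L approximates_mult[OF I G] by auto
    show "dS N s t \<epsilon> f (X N) \<alpha> = cN N * tensor (map (\<lambda>p k. fst p N k / complex_of_real (sqrt (real N))) ?L) \<alpha>"
      if \<alpha>: "\<alpha> \<in> incr_seqs" for N \<alpha>
    proof (cases \<alpha>)
      case Nil
      then show ?thesis using t \<epsilon> by (auto simp: dS_annihilate X intro!: sum.neutral)
    next
      case (Cons b \<beta>)
      define T where "T = tensor (map (\<lambda>p k. fst p N k / complex_of_real (sqrt (real N))) L) \<beta>"
      have "k # \<alpha> \<in> incr_seqs \<longleftrightarrow> k < b" for k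
        using \<alpha> unfolding Cons by (subst incr_seqs_Cons) simp
      then have "dS N s t \<epsilon> f (X N) \<alpha> = (\<Sum>k\<in>{k\<in>{1..N}. k < b}. cnj (dcoeff s t f N k) / sqrt (real N) *
          (cN N * (FN N k / sqrt (real N) * (GN N b / sqrt (real N) * T))))"
        using t \<epsilon> by (auto simp: dS_annihilate X Cons T_def intro!: sum.cong)
      \<comment> \<open>Two factors 1 / sqrt N become the mesh 1/N and the third stays with the new
        first factor. Indices beyond N may be included because their coefficients are 0.\<close>
      also have "\<dots> = (\<Sum>k=1..<b. cN N * (HN N k / real N * (GN N b / sqrt (real N) * T)))"
        using dcoeff_eq_0[OF t]
        by (intro sum.mono_neutral_cong_left) (auto simp: HN_def field_simps simp flip: of_real_mult)
      also have "\<dots> = cN N * ((\<Sum>k=1..<b. HN N k) / real N * (GN N b / sqrt (real N) * T))"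
        by (simp only: sum_distrib_left sum_distrib_right sum_divide_distrib)
      finally show ?thesis by (simp add: Cons T_def)
    qed
    show "cannihilate g Y n u = c * tensor (map snd ?L) (map u [0..<n])" for n u
    proof (cases n)
      case 0
      \<comment> \<open>Y has degree at least two, so its component of degree 1 vanishes and
        annihilation leaves nothing in degree 0.\<close>
      have "Y (Suc n) (case_nat v u) = 0" for v
        unfolding Y map_case_nat_upt by (simp add: 0)
      then show ?thesis by (simp add: cannihilate_def 0)
    next
      case (Suc k)
      define T where "T = tensor (map snd L) (map (\<lambda>i. u (Suc i)) [0..<k])"
      have "Y (Suc n) (case_nat v u) = F v * (c * (G (u 0) * T))" for v
        unfolding Y map_case_nat_upt unfolding Suc map_upt_0_Suc by (simp add: T_def)
      then have "cannihilate g Y n u = (LINT v:{v. v < u 0}|LI. (cnj (g v) * F v) * (c * (G (u 0) * T)))"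
        by (simp add: cannihilate_def Suc mult.assoc)
      also have "\<dots> = I (u 0) * (c * (G (u 0) * T))"
        unfolding I_def by (rule set_integral_mult_left)
      finally show ?thesis unfolding Suc map_upt_0_Suc by (simp add: T_def)
    qed
  qed
  then show ?thesis by (simp add: HN_def I_def[abs_def])
qed

section \<open>The whole product and its vacuum expectation\<close>

lemma op_prod_foldr: "op_prod A m x = foldr A [1..<Suc m] x"
proof -
  have "foldr (\<lambda>i X. A i \<circ> X) is id x = foldr A is x" for "is"
    by (induction "is") auto
  then show ?thesis by (simp add: op_prod_def)
qed

text \<open>Induction along the product, whose last operator acts first. Every operator changes the
  length of L by one, but the direction depends on its sign and on whether L is empty; the parity is
  what can be read off from the number of operators.\<close>

lemma tensors_converge_foldr:
  assumes "\<forall>i\<in>set is. \<epsilon> i \<in> {-1, 1} \<and> f i \<in> riemann_bounded_01 \<and> 0 \<le> s i \<and> s i < t i \<and> t i \<le> 1"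
  shows "\<exists>L. even (length L) = even (length is) \<and>
    tensors_converge L (\<lambda>N. foldr (\<lambda>i. dS N (s i) (t i) (\<epsilon> i) (f i)) is dvacuum)
      (foldr (\<lambda>i. cmode (\<epsilon> i) (\<lambda>x. f i x * indicator {s i..t i} x)) is cvacuum)"
  using assms
proof (induction "is")
  case Nil
  show ?case by (intro exI[of _ "[]"]) (simp add: tensors_converge_vacuum)
next
  case (Cons i "is")
  then obtain L where L: "even (length L) = even (length is)"
    "tensors_converge L (\<lambda>N. foldr (\<lambda>i. dS N (s i) (t i) (\<epsilon> i) (f i)) is dvacuum)
      (foldr (\<lambda>i. cmode (\<epsilon> i) (\<lambda>x. f i x * indicator {s i..t i} x)) is cvacuum)"
    by auto
  let ?g = "\<lambda>x. f i x * indicator {s i..t i} x"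
  have g: "approximates (dcoeff (s i) (t i) (f i)) ?g" and t: "t i \<le> 1"
    using Cons.prems by (auto intro: approximates_dcoeff)
  show ?case
  proof (cases "\<epsilon> i = 1")
    case True
    with L show ?thesis
      using tensors_converge_create[OF L(2) g] by (auto simp: cmode_def intro: exI[of _ "_ # L"])
  next
    case False
    \<comment> \<open>Annihilation has three regimes: nothing to contract, a contraction to a
      scalar, and a contraction into the next factor.\<close>
    consider "L = []" | FN F where "L = [(FN, F)]" | FN F GN G L' where "L = (FN, F) # (GN, G) # L'"
      by (metis neq_Nil_conv surj_pair)
    then show ?thesis
    proof cases
      case 1
      with L False show ?thesis
        using tensors_converge_annihilate_Nil[of _ _ "t i" "\<epsilon> i" "s i" "f i" ?g, OF L(2)[unfolded 1] t False]
        by (auto simp: cmode_def intro!: exI[of _ "[_]"])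
    next
      case 2
      with L False show ?thesis
        using tensors_converge_annihilate_singleton[OF L(2)[unfolded 2] g t False]
        by (auto simp: cmode_def intro!: exI[of _ "[]"])
    next
      case 3
      with L False show ?thesis
        using tensors_converge_annihilate_Cons[OF L(2)[unfolded 3] g t False]
        by (auto simp: cmode_def intro!: exI[of _ "_ # L'"])
    qed
  qed
qed

lemma dinner_dvacuum: "dinner dvacuum x = x []"
proof -
  have "dinner dvacuum x = (\<Sum>\<^sub>\<infinity>\<alpha>\<in>{[]}. x \<alpha>)"
    unfolding dinner_def by (rule infsum_cong_neutral) (auto simp: dvacuum_def dbasis_def)
  then show ?thesis by simp
qed

theorem theorem3p9:
  fixes m :: nat and \<epsilon> :: "nat \<Rightarrow> int" and f :: "nat \<Rightarrow> real \<Rightarrow> complex" and s t :: "nat \<Rightarrow> real"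
  assumes "m \<ge> 1"
    and "\<And>i. i \<in> {1..m} \<Longrightarrow> \<epsilon> i \<in> {-1, 1}"
    and "\<And>i. i \<in> {1..m} \<Longrightarrow> f i \<in> riemann_bounded_01"
    and "\<And>i. i \<in> {1..m} \<Longrightarrow> 0 \<le> s i \<and> s i < t i \<and> t i \<le> 1"
  shows "(\<lambda>N. dvacuum_state (op_prod (\<lambda>i. dS N (s i) (t i) (\<epsilon> i) (f i)) m)) \<longlonglongrightarrow>
    (if odd m then 0
     else cvacuum_state (op_prod (\<lambda>i. cmode (\<epsilon> i) (\<lambda>x. f i x * indicator {s i..t i} x)) m))"
proof -
  have "\<forall>i\<in>set [1..<Suc m]. \<epsilon> i \<in> {-1, 1} \<and> f i \<in> riemann_bounded_01 \<and> 0 \<le> s i \<and> s i < t i \<and> t i \<le> 1"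
    using assms(2-4) by (auto simp del: upt_Suc)
  from tensors_converge_foldr[OF this] obtain L where L: "even (length L) = even m"
    "tensors_converge L (\<lambda>N. op_prod (\<lambda>i. dS N (s i) (t i) (\<epsilon> i) (f i)) m dvacuum)
      (op_prod (\<lambda>i. cmode (\<epsilon> i) (\<lambda>x. f i x * indicator {s i..t i} x)) m cvacuum)"
    by (auto simp: op_prod_foldr simp del: upt_Suc)
  then obtain cN c where c: "cN \<longlonglongrightarrow> c"
    and X: "\<And>N. op_prod (\<lambda>i. dS N (s i) (t i) (\<epsilon> i) (f i)) m dvacuum [] =
      cN N * tensor (map (\<lambda>p k. fst p N k / complex_of_real (sqrt (real N))) L) []"
    and Y: "\<And>u. op_prod (\<lambda>i. cmode (\<epsilon> i) (\<lambda>x. f i x * indicator {s i..t i} x)) m cvacuum 0 u =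
      c * tensor (map snd L) []"
    unfolding tensors_converge_def by force
  show ?thesis
    unfolding dvacuum_state_def cvacuum_state_def dinner_dvacuum cinner_cvacuum X Y
  \<comment> \<open>An empty L forces m to be even, and the claim is the convergence of the scalars.
    A tensor with at least one factor is 0 at the empty sequence, so otherwise both sides vanish for
    either parity; an odd m always falls under this case.\<close>
  proof (cases L)
    case Nil
    with L(1) c show "(\<lambda>N. cN N * tensor (map (\<lambda>p k. fst p N k / complex_of_real (sqrt (real N))) L) []) \<longlonglongrightarrow>
        (if odd m then 0 else c * tensor (map snd L) [])" by simp
  qed simp
qed

end
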